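(* Let $\alpha \geq 0$ and $0 \leq \beta < \frac{3}{2} + \alpha$, and let $0 \leq \nu < 3$ with $\nu \leq 2\beta$. There is a constant $C_\nu > 0$ (depending only on $\alpha,\beta,\nu$) such that $$\sup_{b \leq y \leq b+1} \frac{|u(y)|^2}{y^{\nu}} \leq C_\nu \, h_b[u]$$ for any $b > 0$ and any $u \in H^2(b,b+1)$ that satisfies $$\int_b^{b+1} u(x)\, x^\beta \, dx = 0 \quad\text{and}\quad \int_b^{b+1} \left( \frac{u(x)}{x^\beta} \right)' x^\alpha \, dx = 0.$$
   Context: For $b>0$, the quadratic form $h_b$ has domain the Sobolev space $H^2(b,b+1)$ (of complex-valued functions) and is given by $$h_b[u] = \int_b^{b+1} \left| \left( \frac{1}{x^\alpha}\left( \frac{u(x)}{x^\beta} \right)' \right)' \right|^2 x^{2(\alpha+\beta)} \, dx.$$ *)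

theory Defs
  imports "HOL-Analysis.Analysis"
begin

definition test_function :: "real \<Rightarrow> real \<Rightarrow> (real \<Rightarrow> real) \<Rightarrow> bool" where
  "test_function a b \<phi> \<longleftrightarrow>
     (\<forall>k. (deriv ^^ k) \<phi> differentiable_on UNIV) \<and>
     compact (closure {x. \<phi> x \<noteq> 0}) \<and> closure {x. \<phi> x \<noteq> 0} \<subseteq> {a<..<b}"

definition locally_integrable :: "real \<Rightarrow> real \<Rightarrow> (real \<Rightarrow> complex) \<Rightarrow> bool" where
  "locally_integrable a b f \<longleftrightarrow>
     (\<forall>K. compact K \<longrightarrow> K \<subseteq> {a<..<b} \<longrightarrow> integrable (lebesgue_on K) f)"

definition has_weak_deriv ::
    "nat \<Rightarrow> real \<Rightarrow> real \<Rightarrow> (real \<Rightarrow> complex) \<Rightarrow> (real \<Rightarrow> complex) \<Rightarrow> bool" where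
  "has_weak_deriv k a b f g \<longleftrightarrow>
     locally_integrable a b f \<and> locally_integrable a b g \<and>
     (\<forall>\<phi>. test_function a b \<phi> \<longrightarrow>
        (LINT x|lebesgue_on {a<..<b}. (deriv ^^ k) \<phi> x *\<^sub>R f x) =
        (-1) ^ k * (LINT x|lebesgue_on {a<..<b}. \<phi> x *\<^sub>R g x))"

text \<open>Weak derivatives are determined up to null sets only, so the following selects a
  representative. Neither a weak derivative nor an integral of an expression in it depends
  on the choice.\<close>

definition weak_deriv :: "real \<Rightarrow> real \<Rightarrow> (real \<Rightarrow> complex) \<Rightarrow> real \<Rightarrow> complex" where
  "weak_deriv a b f = (SOME g. has_weak_deriv 1 a b f g)"

definition L2 :: "real \<Rightarrow> real \<Rightarrow> (real \<Rightarrow> complex) set" where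
  "L2 a b = {f. f \<in> borel_measurable (lebesgue_on {a<..<b}) \<and>
                integrable (lebesgue_on {a<..<b}) (\<lambda>x. (cmod (f x))\<^sup>2)}"

definition sobolev_H :: "nat \<Rightarrow> real \<Rightarrow> real \<Rightarrow> (real \<Rightarrow> complex) set" where
  "sobolev_H m a b = {u \<in> L2 a b. \<forall>k\<le>m. \<exists>g\<in>L2 a b. has_weak_deriv k a b u g}"

text \<open>Members of \<open>sobolev_H\<close> are arbitrary representatives of their a.e. classes. Pointwise
  values refer to the representative that is continuous on the closed interval; it exists for
  \<open>m \<ge> 1\<close> by the Sobolev embedding and is unique on \<open>{a..b}\<close>.\<close>

definition continuous_rep :: "real \<Rightarrow> real \<Rightarrow> (real \<Rightarrow> complex) \<Rightarrow> real \<Rightarrow> complex" where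
  "continuous_rep a b u =
     (SOME v. continuous_on {a..b} v \<and> (AE x in lebesgue_on {a<..<b}. v x = u x))"

definition h_form :: "real \<Rightarrow> real \<Rightarrow> real \<Rightarrow> (real \<Rightarrow> complex) \<Rightarrow> real" where
  "h_form \<alpha> \<beta> b u =
     (LINT x|lebesgue_on {b<..<b+1}.
        (cmod (weak_deriv b (b+1)
           (\<lambda>t. (1 / of_real (t powr \<alpha>)) *
                weak_deriv b (b+1) (\<lambda>s. u s / of_real (s powr \<beta>)) t) x))\<^sup>2
        * x powr (2 * (\<alpha> + \<beta>)))"

end

theory Submission
  imports Defs
begin

text \<open>
  Put \<open>v = u / x powr \<beta>\<close> and \<open>w = v' / x powr \<alpha>\<close>, so that \<open>h\<close> is the integral of
  \<open>\<bar>w'\<bar>\<^sup>2 x powr (2 * (\<alpha> + \<beta>))\<close> and the two constraints say that \<open>w\<close> and \<open>v\<close> have mean zero for the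
  weights \<open>x powr (2 * \<alpha>)\<close> and \<open>x powr (2 * \<beta>)\<close>. A function \<open>F\<close> with mean zero for \<open>x powr (2 * p)\<close> is
  recovered from \<open>F'\<close> through a kernel which is \<open>O(t powr (2 * p + 1))\<close> to the left of the
  evaluation point and bounded to its right. For \<open>b \<le> 1\<close> this is applied to \<open>w\<close>, with the
  Cauchy-Schwarz inequality, giving \<open>\<bar>w x\<bar> \<le> C x powr - \<delta> sqrt h\<close> for a suitable \<open>\<delta>\<close>, and then
  to \<open>v\<close>; the conditions \<open>\<beta> < 3/2 + \<alpha>\<close> and \<open>\<nu> < 3\<close> make the powers of \<open>x\<close> that
  occur integrable at 0. For \<open>b \<ge> 1\<close> every power of \<open>x\<close> on the interval is
  comparable to the same power of \<open>b\<close>, and the bound of \<open>F\<close> by the integral of \<open>\<bar>F'\<bar>\<close> suffices.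
\<close>

subsection \<open>Smooth bump functions\<close>

text \<open>The obstacle is uniformity as b tends to 0, where the weight of the form degenerates.
  Write \<sigma> = \<alpha> + \<beta> and \<gamma> = \<nu> / 2. In the step for w, Cauchy-Schwarz
  pairs the left part of the kernel, t^(2\<alpha>+1), with t^(-\<sigma>); the square is integrable
  at 0 exactly when 2\<alpha> + 2 - 2\<beta> > -1, which is \<beta> < 3/2 + \<alpha>. The right part
  carries t^\<delta> t^(-\<sigma>) and asks for \<delta> > \<sigma> - 1/2. In the step for v the
  integrand is bounded by t^(\<sigma>-\<gamma>-\<delta>), which asks for \<delta> < \<sigma> -
  \<gamma> + 1. Such a \<delta> exists exactly when \<gamma> < 3/2, that is \<nu> < 3. The condition
  \<nu> \<le> 2\<beta> makes the exponent of y^(\<beta>-\<gamma>) nonnegative, so this factor can be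
  moved under an integral to the right of y. For large b a factor b^(-\<gamma>) is left over,
  bounded by 1 because \<gamma> \<ge> 0. As u is merely in H^2, v and w are treated as indefinite
  integrals instead of through pointwise derivatives. Most of the work before the estimates shows
  that weak derivatives on an interval amount to this; it rests on explicit bump functions.\<close>

definition smooth :: "(real \<Rightarrow> real) \<Rightarrow> bool" where
  "smooth f \<longleftrightarrow> (\<forall>k. (deriv ^^ k) f differentiable_on UNIV)"

text \<open>Iterated derivatives of products or of \<open>flat_exp\<close> have no convenient closed
  form; a set closed under \<open>deriv\<close> replaces a formula for
  \<open>(deriv ^^ k) f\<close>.\<close>

lemma smooth_coinduct:
  assumes "f \<in> S" and "\<And>g. g \<in> S \<Longrightarrow> g differentiable_on UNIV \<and> deriv g \<in> S"
  shows "smooth f"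
proof -
  have "(deriv ^^ k) f \<in> S" for k
    by (induction k) (use assms in auto)
  then show ?thesis
    using assms(2) by (auto simp: smooth_def)
qed

lemma smooth_deriv: "smooth f \<Longrightarrow> smooth (deriv f)"
  unfolding smooth_def by (metis comp_apply funpow_Suc_right)

lemma smooth_has_real_derivative:
  assumes "smooth f"
  shows "(f has_real_derivative deriv f x) (at x)"
proof -
  have "f differentiable_on UNIV"
    using assms unfolding smooth_def by (metis funpow_0)
  then have "f field_differentiable (at x)"
    by (simp add: differentiable_on_def field_differentiable_def real_differentiable_def)
  then show ?thesis
    by (rule field_differentiable_derivI)
qed

lemma smooth_continuous_on: "smooth f \<Longrightarrow> continuous_on A f"
  by (meson DERIV_isCont continuous_at_imp_continuous_on smooth_has_real_derivative)

lemma differentiable_onI_real: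
  assumes "\<And>x. (f has_real_derivative f' x) (at x)"
  shows "f differentiable_on UNIV"
  using assms by (auto simp: differentiable_on_def real_differentiable_def)

lemma deriv_eqI:
  assumes "\<And>x. (f has_field_derivative f' x) (at x)"
  shows "deriv f = f'"
  using assms DERIV_imp_deriv by blast

lemma smooth_antideriv:
  assumes "\<And>x. (f has_real_derivative f' x) (at x)" and "smooth f'"
  shows "smooth f"
  unfolding smooth_def
proof
  fix k
  show "(deriv ^^ k) f differentiable_on UNIV"
  proof (cases k)
    case 0
    then show ?thesis using differentiable_onI_real[OF assms(1)] by simp
  next
    case (Suc m)
    then have "(deriv ^^ k) f = (deriv ^^ m) f'"
      by (metis assms(1) comp_apply deriv_eqI funpow_Suc_right)
    then show ?thesis using assms(2) by (simp add: smooth_def)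
  qed
qed

text \<open>The outer factor \<open>r\<close> absorbs the factor \<open>m\<close> that the chain
  rule produces at each differentiation.\<close>

lemma smooth_affine:
  assumes "smooth f"
  shows "smooth (\<lambda>x. r * f (m * x + c))"
proof -
  let ?S = "{\<lambda>x. r * g (m * x + c) | g r. smooth g}"
  show ?thesis
  proof (rule smooth_coinduct[where S = ?S])
    fix h assume "h \<in> ?S"
    then obtain g r where h: "h = (\<lambda>x. r * g (m * x + c))" and g: "smooth g"
      by blast
    have d: "(h has_real_derivative (r * m) * deriv g (m * x + c)) (at x)" for x
    proof -
      have "((\<lambda>x. g (m * x + c)) has_real_derivative deriv g (m * x + c) * m) (at x)"
        by (rule DERIV_chain2[OF smooth_has_real_derivative[OF g]]) (auto intro!: derivative_eq_intros)
      from DERIV_cmult[OF this, of r] show ?thesis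
        by (simp add: h mult_ac)
    qed
    show "h differentiable_on UNIV \<and> deriv h \<in> ?S"
      using differentiable_onI_real[OF d] deriv_eqI[OF d] smooth_deriv[OF g] by auto
  qed (use assms in blast)
qed

lemma smooth_cmult: "smooth f \<Longrightarrow> smooth (\<lambda>x. r * f x)"
  using smooth_affine[of f r 1 0] by simp

lemma smooth_add:
  assumes "smooth f" "smooth g"
  shows "smooth (\<lambda>x. f x + g x)"
proof -
  let ?S = "{\<lambda>x. f x + g x | f g. smooth f \<and> smooth g}"
  show ?thesis
  proof (rule smooth_coinduct[where S = ?S])
    fix h assume "h \<in> ?S"
    then obtain f g where h: "h = (\<lambda>x. f x + g x)" and fg: "smooth f" "smooth g"
      by blast
    have d: "(h has_real_derivative deriv f x + deriv g x) (at x)" for x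
      unfolding h by (intro DERIV_add smooth_has_real_derivative fg)
    show "h differentiable_on UNIV \<and> deriv h \<in> ?S"
      using differentiable_onI_real[OF d] deriv_eqI[OF d] smooth_deriv[OF fg(1)] smooth_deriv[OF fg(2)]
      by auto
  qed (use assms in blast)
qed

text \<open>The Leibniz rule turns one product into a sum of two, so products alone are not closed
  under \<open>deriv\<close>; finite sums of them are.\<close>

inductive_set product_sums :: "(real \<Rightarrow> real) set" where
  "smooth f \<Longrightarrow> smooth g \<Longrightarrow> (\<lambda>x. f x * g x) \<in> product_sums"
| "f \<in> product_sums \<Longrightarrow> g \<in> product_sums \<Longrightarrow> (\<lambda>x. f x + g x) \<in> product_sums"

lemma product_sums_deriv:
  assumes "h \<in> product_sums"
  shows "\<exists>h'\<in>product_sums. \<forall>x. (h has_real_derivative h' x) (at x)"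
  using assms
proof induction
  case (1 f g)
  have "((\<lambda>x. f x * g x) has_real_derivative deriv f x * g x + deriv g x * f x) (at x)" for x
    by (intro DERIV_mult smooth_has_real_derivative 1)
  moreover have "(\<lambda>x. deriv f x * g x + deriv g x * f x) \<in> product_sums"
    by (intro product_sums.intros smooth_deriv 1)
  ultimately show ?case
    by (intro bexI[of _ "\<lambda>x. deriv f x * g x + deriv g x * f x"]) auto
next
  case (2 f g)
  then obtain f' g' where "f' \<in> product_sums" "g' \<in> product_sums"
    "\<And>x. (f has_real_derivative f' x) (at x)" "\<And>x. (g has_real_derivative g' x) (at x)"
    by blast
  then show ?case
    by (intro bexI[of _ "\<lambda>x. f' x + g' x"] allI DERIV_add product_sums.intros(2))
qed

lemma smooth_mult:
  assumes "smooth f" "smooth g"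
  shows "smooth (\<lambda>x. f x * g x)"
proof (rule smooth_coinduct)
  show "(\<lambda>x. f x * g x) \<in> product_sums"
    by (intro product_sums.intros assms)
next
  fix h assume "h \<in> product_sums"
  then obtain h' where "h' \<in> product_sums" "\<And>x. (h has_real_derivative h' x) (at x)"
    using product_sums_deriv by blast
  then show "h differentiable_on UNIV \<and> deriv h \<in> product_sums"
    using differentiable_onI_real deriv_eqI by metis
qed

section \<open>The flat function exp(-1/x), its derivatives, and bumps built from it\<close>

text \<open>The polynomial parameter makes the family closed under differentiation: every derivative
  of exp(-1/x), extended by 0, is of this kind.\<close>

definition flat_exp :: "real poly \<Rightarrow> real \<Rightarrow> real" where
  "flat_exp p x = (if x > 0 then poly p (1 / x) * exp (- (1 / x)) else 0)"

lemma poly_mult_exp_tendsto_0: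
  fixes p :: "real poly"
  shows "((\<lambda>z. poly p z * exp (- z)) \<longlongrightarrow> 0) at_top"
proof -
  have "((\<lambda>z. \<Sum>i\<le>degree p. coeff p i * (z ^ i / exp z)) \<longlongrightarrow> (\<Sum>i\<le>degree p. coeff p i * 0)) at_top"
    by (intro tendsto_intros tendsto_power_div_exp_0)
  moreover have "(\<Sum>i\<le>degree p. coeff p i * (z ^ i / exp z)) = poly p z * exp (- z)" for z
    by (simp add: poly_altdef sum_distrib_right exp_minus field_simps sum_divide_distrib)
  ultimately show ?thesis by simp
qed

lemma flat_exp_tendsto_0: "(flat_exp p \<longlongrightarrow> 0) (at 0)"
proof -
  have "((\<lambda>x. poly p (inverse x) * exp (- inverse x)) \<longlongrightarrow> 0) (at_right 0)"
    by (rule filterlim_compose[OF poly_mult_exp_tendsto_0 filterlim_inverse_at_top_right])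
  moreover have "\<forall>\<^sub>F x in at_right 0. poly p (inverse x) * exp (- inverse x) = flat_exp p x"
    using eventually_at_right_less[of 0] by eventually_elim (simp add: flat_exp_def inverse_eq_divide)
  ultimately have "(flat_exp p \<longlongrightarrow> 0) (at_right 0)"
    by (simp add: tendsto_cong)
  moreover have "(flat_exp p \<longlongrightarrow> 0) (at_left 0)"
    by (rule tendsto_eventually) (auto simp: flat_exp_def eventually_at_filter)
  ultimately show ?thesis
    by (simp add: filterlim_split_at)
qed

text \<open>With z = 1/x, d/dx is -z^2 d/dz, and the z-derivative of p(z) exp(-z) is (p' - p)(z)
  exp(-z); \<open>[:0, 0, 1:]\<close> is the polynomial z^2.\<close>

lemma flat_exp_has_real_derivative:
  "(flat_exp p has_real_derivative flat_exp ([:0, 0, 1:] * (p - pderiv p)) x) (at x)"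
proof -
  consider "x > 0" | "x < 0" | "x = 0" by linarith
  then show ?thesis
  proof cases
    case 1
    have "((\<lambda>x. poly p (1 / x) * exp (- (1 / x))) has_real_derivative
        flat_exp ([:0, 0, 1:] * (p - pderiv p)) x) (at x)"
      using 1 by (auto intro!: derivative_eq_intros DERIV_chain2[OF poly_DERIV]
          simp: flat_exp_def field_simps power2_eq_square)
    moreover have "\<forall>\<^sub>F y in nhds x. flat_exp p y = poly p (1 / y) * exp (- (1 / y))"
      using eventually_nhds_in_open[of "{0<..}" x] 1
      by (auto elim!: eventually_mono simp: flat_exp_def)
    ultimately show ?thesis
      by (subst DERIV_cong_ev) auto
  next
    case 2
    have "\<forall>\<^sub>F y in nhds x. flat_exp p y = 0"
      using eventually_nhds_in_open[of "{..<0}" x] 2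
      by (auto elim!: eventually_mono simp: flat_exp_def)
    moreover have "flat_exp ([:0, 0, 1:] * (p - pderiv p)) x = 0"
      using 2 by (simp add: flat_exp_def)
    ultimately show ?thesis
      by (subst DERIV_cong_ev[where g = "\<lambda>_. 0"]) auto
  next
    case 3
    \<comment> \<open>Dividing by \<open>h\<close> multiplies the polynomial by z = 1/h, so the
      difference quotient at 0 stays in the family and tends to 0.\<close>
    have "flat_exp p h / h = flat_exp (pCons 0 p) h" for h
      by (simp add: flat_exp_def)
    then have "((\<lambda>h. (flat_exp p (0 + h) - flat_exp p 0) / h) \<longlongrightarrow> 0) (at 0)"
      using flat_exp_tendsto_0[of "pCons 0 p"] by (simp add: flat_exp_def[of p 0])
    then show ?thesis
      unfolding 3 DERIV_def by (simp add: flat_exp_def[of _ 0])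
  qed
qed

lemma smooth_flat_exp: "smooth (flat_exp p)"
proof (rule smooth_coinduct[where S = "range flat_exp"])
  fix g assume "g \<in> range flat_exp"
  then obtain p where "g = flat_exp p" by blast
  then show "g differentiable_on UNIV \<and> deriv g \<in> range flat_exp"
    using differentiable_onI_real[OF flat_exp_has_real_derivative]
      deriv_eqI[OF flat_exp_has_real_derivative] by blast
qed simp

text \<open>The factor \<open>Suc n\<close> drives both exponentials to 1 inside
  \<open>{c<..<d}\<close> while the support stays fixed: a smooth pointwise approximation of the
  indicator, bounded by 1.\<close>

definition bump :: "real \<Rightarrow> real \<Rightarrow> nat \<Rightarrow> real \<Rightarrow> real" where
  "bump c d n x = flat_exp 1 (real (Suc n) * (x - c)) * flat_exp 1 (real (Suc n) * (d - x))"

lemma smooth_bump: "smooth (bump c d n)"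
proof -
  have "smooth (\<lambda>x. (1 * flat_exp 1 (real (Suc n) * x + - (real (Suc n) * c))) *
      (1 * flat_exp 1 (- real (Suc n) * x + real (Suc n) * d)))"
    by (intro smooth_mult smooth_affine smooth_flat_exp)
  moreover have "(\<lambda>x. (1 * flat_exp 1 (real (Suc n) * x + - (real (Suc n) * c))) *
      (1 * flat_exp 1 (- real (Suc n) * x + real (Suc n) * d))) = bump c d n"
    by (auto simp: fun_eq_iff bump_def algebra_simps)
  ultimately show ?thesis by simp
qed

lemma bump_bounds: "0 \<le> bump c d n x" "bump c d n x \<le> 1"
proof -
  have "0 \<le> flat_exp 1 y" "flat_exp 1 y \<le> 1" for y
    by (auto simp: flat_exp_def)
  then show "0 \<le> bump c d n x" "bump c d n x \<le> 1"
    unfolding bump_def by (auto intro: mult_nonneg_nonneg mult_le_one)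
qed

lemma bump_pos_iff: "bump c d n x > 0 \<longleftrightarrow> x \<in> {c<..<d}"
  by (auto simp: bump_def flat_exp_def zero_less_mult_iff)

lemma bump_tendsto: "(\<lambda>n. bump c d n x) \<longlonglongrightarrow> indicator {c<..<d} x"
proof (cases "x \<in> {c<..<d}")
  case True
  have "(\<lambda>n. flat_exp 1 (real (Suc n) * y)) \<longlonglongrightarrow> 1" if "y > 0" for y
  proof -
    have "(\<lambda>n. exp (- (inverse (real (Suc n)) * inverse y))) \<longlonglongrightarrow> exp (- (0 * inverse y))"
      by (intro tendsto_intros LIMSEQ_inverse_real_of_nat)
    then show ?thesis
      using that by (simp add: flat_exp_def zero_less_mult_iff inverse_eq_divide)
  qed
  from tendsto_mult[OF this this, of "x - c" "d - x"] True show ?thesis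
    unfolding bump_def by simp
next
  case False
  then have "bump c d n x = 0" for n
    using bump_pos_iff[of c d n x] bump_bounds[of c d n x] by linarith
  then show ?thesis using False by simp
qed

section \<open>Test functions as smooth functions vanishing off a smaller closed interval\<close>

lemma test_functionI:
  assumes "smooth \<phi>" "a < c" "d < b" "\<And>x. x \<notin> {c..d} \<Longrightarrow> \<phi> x = 0"
  shows "test_function a b \<phi>"
proof -
  have "closure {x. \<phi> x \<noteq> 0} \<subseteq> {c..d}"
    by (rule closure_minimal) (use assms(4) in blast, simp)
  moreover from this have "compact (closure {x. \<phi> x \<noteq> 0})"
    using compact_Icc[of c d] closed_Int_compact[OF closed_closure] by (metis inf.absorb1)
  ultimately show ?thesis
    using assms(1-3) unfolding test_function_def smooth_def by fastforce
qed

lemma test_functionD: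
  assumes "test_function a b \<phi>"
  obtains c d where "smooth \<phi>" "a < c" "d < b" "\<And>x. x \<notin> {c..d} \<Longrightarrow> \<phi> x = 0"
proof -
  define K where "K = closure {x. \<phi> x \<noteq> 0}"
  have K: "smooth \<phi>" "compact K" "K \<subseteq> {a<..<b}"
    using assms by (auto simp: test_function_def smooth_def K_def)
  have sub: "\<phi> x \<noteq> 0 \<Longrightarrow> x \<in> K" for x
    using closure_subset by (fastforce simp: K_def)
  show ?thesis
  proof (cases "K = {}")
    case True
    show ?thesis
    \<comment> \<open>With empty support \<open>\<phi>\<close> vanishes everywhere, and any
      \<open>c\<close> above \<open>a\<close> and \<open>d\<close> below \<open>b\<close> will
      do.\<close>
    proof (rule that[of "a + 1" "b - 1"])
    qed (use K sub True in auto)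
  next
    case False
    obtain c where c: "c \<in> K" "\<And>x. x \<in> K \<Longrightarrow> c \<le> x"
      using compact_attains_inf[OF K(2) False] by blast
    obtain d where d: "d \<in> K" "\<And>x. x \<in> K \<Longrightarrow> x \<le> d"
      using compact_attains_sup[OF K(2) False] by blast
    show ?thesis
    proof (rule that[of c d])
    qed (use K sub c d in fastforce)+
  qed
qed

subsection \<open>Primitives of integrable functions\<close>

lemma absolutely_integrable_scaleR_continuous:
  fixes f :: "real \<Rightarrow> 'a::euclidean_space"
  assumes "continuous_on {a..b} A" "f absolutely_integrable_on {a..b}"
  shows "(\<lambda>x. A x *\<^sub>R f x) absolutely_integrable_on {a..b}"
proof (rule absolutely_integrable_bounded_measurable_product[where h = "\<lambda>(r::real) (x::'a). r *\<^sub>R x"])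
  show "bilinear (\<lambda>(r::real) (x::'a). r *\<^sub>R x)"
    by (simp add: bilinear_conv_bounded_bilinear bounded_bilinear_scaleR)
  show "A \<in> borel_measurable (lebesgue_on {a..b})"
    using assms(1) by (intro continuous_imp_measurable_on_sets_lebesgue) auto
  show "bounded (A ` {a..b})"
    using assms(1) by (intro compact_imp_bounded compact_continuous_image) auto
qed (use assms in auto)

lemma absolutely_integrable_onD:
  fixes f :: "'a::euclidean_space \<Rightarrow> 'b::euclidean_space"
  assumes "f absolutely_integrable_on S"
  shows "f integrable_on S" "(\<lambda>x. norm (f x)) integrable_on S"
  using assms by (simp_all add: absolutely_integrable_on_def)

text \<open>Absolute continuity of \<open>F\<close> with derivative \<open>f\<close>, expressed by
  the integral identity alone: for integrable \<open>f\<close> the function \<open>F\<close> need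
  not be differentiable at every point, but the identity holds at every point.\<close>

definition primitive_on ::
    "real \<Rightarrow> real \<Rightarrow> (real \<Rightarrow> 'a::euclidean_space) \<Rightarrow> (real \<Rightarrow> 'a) \<Rightarrow> bool" where
  "primitive_on a b F f \<longleftrightarrow>
     f absolutely_integrable_on {a..b} \<and> (\<forall>x\<in>{a..b}. F x = F a + integral {a..x} f)"

lemma primitive_onD:
  assumes "primitive_on a b F f"
  shows "f absolutely_integrable_on {a..b}"
    and "a \<le> x \<Longrightarrow> x \<le> b \<Longrightarrow> F x = F a + integral {a..x} f"
  using assms unfolding primitive_on_def by (blast, meson atLeastAtMost_iff)

lemma primitive_on_diff:
  assumes "primitive_on a b F f" "a \<le> x" "x \<le> y" "y \<le> b"
  shows "F y - F x = integral {x..y} f"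
proof -
  have "f integrable_on {a..y}"
    using assms by (meson absolutely_integrable_onD(1) absolutely_integrable_on_subinterval
        atLeastatMost_subset_iff order_refl primitive_on_def)
  then have *: "integral {a..x} f + integral {x..y} f = integral {a..y} f"
    using assms by (intro Henstock_Kurzweil_Integration.integral_combine) auto
  have "F x = F a + integral {a..x} f" "F y = F a + integral {a..y} f"
    using assms(2-) by (intro primitive_onD(2)[OF assms(1)]; linarith)+
  then have "F y - F x = integral {a..y} f - integral {a..x} f"
    by (simp only: add_diff_cancel_left)
  then show ?thesis
    by (simp only: *[symmetric] add_diff_cancel_left')
qed

lemma primitive_on_continuous:
  assumes "primitive_on a b F f"
  shows "continuous_on {a..b} F"
proof -
  have "continuous_on {a..b} (\<lambda>x. F a + integral {a..x} f)"
    using assms by (intro continuous_intros indefinite_integral_continuous_1 absolutely_integrable_onD(1))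
      (simp add: primitive_on_def)
  then show ?thesis
    by (rule continuous_on_eq) (metis assms atLeastAtMost_iff primitive_onD(2))
qed

lemma primitive_on_subinterval:
  assumes "primitive_on a b F f" "a \<le> c" "d \<le> b"
  shows "primitive_on c d F f"
  unfolding primitive_on_def
proof (intro conjI ballI)
  show "f absolutely_integrable_on {c..d}"
    using assms by (meson absolutely_integrable_on_subinterval atLeastatMost_subset_iff primitive_on_def)
  fix x assume "x \<in> {c..d}"
  then show "F x = F c + integral {c..x} f"
    using primitive_on_diff[OF assms(1), of c x] assms by (auto simp: algebra_simps)
qed

lemma primitive_on_C1:
  fixes F :: "real \<Rightarrow> 'a::euclidean_space"
  assumes "\<And>x. x \<in> {a..b} \<Longrightarrow> (F has_vector_derivative f x) (at x within {a..b})"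
    and "continuous_on {a..b} f"
  shows "primitive_on a b F f"
  unfolding primitive_on_def
proof (intro conjI ballI)
  show "f absolutely_integrable_on {a..b}"
    by (rule absolutely_integrable_continuous_real[OF assms(2)])
  fix x assume x: "x \<in> {a..b}"
  have "(f has_integral F x - F a) {a..x}"
  proof (rule fundamental_theorem_of_calculus)
    fix y assume "y \<in> {a..x}"
    then show "(F has_vector_derivative f y) (at y within {a..x})"
      using x assms(1)[of y] by (auto intro: has_vector_derivative_within_subset)
  qed (use x in auto)
  then show "F x = F a + integral {a..x} f"
    by (simp add: integral_unique)
qed

text \<open>Divided by \<open>y - x\<close>, the increment of \<open>D\<close> is at most
  \<open>\<bar>G y - G x\<bar>\<close>, which tends to 0 by continuity of \<open>G\<close>; so
  \<open>D\<close> has derivative 0 everywhere.\<close>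

lemma constant_on_if_superlinear_increments:
  fixes D :: "real \<Rightarrow> 'a::euclidean_space" and G :: "real \<Rightarrow> real"
  assumes G: "continuous_on {a..b} G"
    and D: "\<And>x y. a \<le> x \<Longrightarrow> x \<le> y \<Longrightarrow> y \<le> b \<Longrightarrow> norm (D y - D x) \<le> (y - x) * \<bar>G y - G x\<bar>"
    and "x \<in> {a..b}"
  shows "D x = D a"
proof -
  have le: "norm (D y - D x) \<le> norm (y - x) * \<bar>G y - G x\<bar>" if "x \<in> {a..b}" "y \<in> {a..b}" for x y
    using D[of x y] D[of y x] that by (cases "x \<le> y") (auto simp: norm_minus_commute abs_minus_commute)
  have "(D has_derivative (\<lambda>h. 0)) (at x within {a..b})" if x: "x \<in> {a..b}" for x
    unfolding has_derivative_within
  proof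
    have "(G \<longlongrightarrow> G x) (at x within {a..b})"
      using G x by (auto simp: continuous_on_def)
    then have "((\<lambda>y. \<bar>G y - G x\<bar>) \<longlongrightarrow> \<bar>G x - G x\<bar>) (at x within {a..b})"
      by (intro tendsto_intros)
    then have "((\<lambda>y. \<bar>G y - G x\<bar>) \<longlongrightarrow> 0) (at x within {a..b})"
      by simp
    moreover have "\<forall>\<^sub>F y in at x within {a..b}. norm ((1 / norm (y - x)) *\<^sub>R (D y - (D x + 0))) \<le> \<bar>G y - G x\<bar>"
      unfolding eventually_at_filter
      using le[OF x] by (auto intro!: always_eventually simp: divide_simps mult_ac)
    ultimately show "((\<lambda>y. (1 / norm (y - x)) *\<^sub>R (D y - (D x + 0))) \<longlongrightarrow> 0) (at x within {a..b})"
      by (rule Lim_null_comparison[rotated])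
  qed simp
  from has_derivative_zero_unique[OF convex_real_interval(5) this assms(3), of a] show ?thesis
    using assms(3) by simp
qed

text \<open>The difference of \<open>A x *\<^sub>R F x\<close> and the indefinite integral has increments bounded by
  \<open>y - x\<close> times the increment of a multiple of the primitive of \<open>norm f\<close>. Hence it has derivative zero everywhere, even
  though \<open>F\<close> itself is differentiable only almost everywhere.\<close>

lemma primitive_on_scaleR:
  fixes F :: "real \<Rightarrow> 'a::euclidean_space"
  assumes F: "primitive_on a b F f"
    and A: "\<And>x. x \<in> {a..b} \<Longrightarrow> (A has_real_derivative A' x) (at x within {a..b})"
    and A': "continuous_on {a..b} A'"
  shows "primitive_on a b (\<lambda>x. A x *\<^sub>R F x) (\<lambda>x. A' x *\<^sub>R F x + A x *\<^sub>R f x)"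
proof -
  let ?g = "\<lambda>x. A' x *\<^sub>R F x + A x *\<^sub>R f x"
  have f: "f absolutely_integrable_on {a..b}"
    using F by (simp add: primitive_on_def)
  have Ac: "continuous_on {a..b} A"
    by (rule DERIV_continuous_on[OF A])
  note Fc = primitive_on_continuous[OF F]
  have A'F: "(\<lambda>x. A' x *\<^sub>R F x) absolutely_integrable_on {a..b}"
    by (intro absolutely_integrable_continuous_real continuous_intros A' Fc)
  have g: "?g absolutely_integrable_on {a..b}"
    by (rule set_integral_add(1)[OF A'F absolutely_integrable_scaleR_continuous[OF Ac f]])
  obtain L where L: "\<And>x. x \<in> {a..b} \<Longrightarrow> \<bar>A' x\<bar> \<le> L"
    using compact_imp_bounded[OF compact_continuous_image[OF A' compact_Icc]]
    unfolding bounded_iff by fastforce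
  have A_prim: "primitive_on a b A A'"
    by (rule primitive_on_C1[OF _ A']) (use A in \<open>simp add: has_real_derivative_iff_has_vector_derivative\<close>)
  define D where "D x = A x *\<^sub>R F x - A a *\<^sub>R F a - integral {a..x} ?g" for x
  \<comment> \<open>Two error terms below contribute at most \<open>L * (y - x) * N\<close> each,
    hence the factor 2.\<close>
  define G where "G x = 2 * L * integral {a..x} (\<lambda>t. norm (f t))" for x
  have "D x = D a" if "x \<in> {a..b}" for x
  proof (rule constant_on_if_superlinear_increments[of a b G])
    show "continuous_on {a..b} G"
      unfolding G_def
      by (intro continuous_intros indefinite_integral_continuous_1 absolutely_integrable_onD f)
  next
    fix x y assume xy: "a \<le> x" "x \<le> y" "y \<le> b"
    then have sub: "{x..y} \<subseteq> {a..b}" by auto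
    note abs_xy = absolutely_integrable_on_subinterval[OF _ sub]
    define N where "N = integral {x..y} (\<lambda>t. norm (f t))"
    have int_combine: "integral {a..y} h - integral {a..x} h = integral {x..y} h"
      if "h integrable_on {a..b}" for h :: "real \<Rightarrow> 'c::euclidean_space"
    proof -
      have "h integrable_on {a..y}"
        by (rule integrable_on_subinterval[OF that]) (use xy in auto)
      then have "integral {a..x} h + integral {x..y} h = integral {a..y} h"
        using xy by (intro Henstock_Kurzweil_Integration.integral_combine) auto
      then show ?thesis by (simp add: algebra_simps)
    qed
    have N: "G y - G x = 2 * L * N"
      using int_combine[OF absolutely_integrable_onD(2)[OF f]]
      unfolding G_def N_def by (simp add: right_diff_distrib[symmetric])
    have "N \<ge> 0"
      unfolding N_def by (intro integral_nonneg absolutely_integrable_onD abs_xy f) auto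
    have "L \<ge> 0"
      using L[of a] xy by auto
    have i1: "(\<lambda>t. A y *\<^sub>R f t) integrable_on {x..y}"
      by (intro integrable_cmul absolutely_integrable_onD abs_xy f)
    have i2: "(\<lambda>t. A' t *\<^sub>R F x) integrable_on {x..y}"
      by (intro integrable_continuous_real continuous_intros continuous_on_subset[OF A' sub])
    have i3: "?g integrable_on {x..y}"
      by (intro absolutely_integrable_onD abs_xy g)
    \<comment> \<open>Evaluating \<open>A\<close> at the right end and \<open>F\<close> at the left
      end splits the increment exactly, without a second-order term.\<close>
    have "A y *\<^sub>R F y - A x *\<^sub>R F x = A y *\<^sub>R (F y - F x) + (A y - A x) *\<^sub>R F x"
      by (simp add: algebra_simps)
    also have "\<dots> = integral {x..y} (\<lambda>t. A y *\<^sub>R f t) + integral {x..y} (\<lambda>t. A' t *\<^sub>R F x)"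
    proof -
      have "integral {x..y} (\<lambda>t. A' t *\<^sub>R F x) = integral {x..y} A' *\<^sub>R F x"
        using integral_linear[of A' "{x..y}" "\<lambda>r. r *\<^sub>R F x"]
          integrable_continuous_real[OF continuous_on_subset[OF A' sub]]
        by (simp add: o_def bounded_linear_scaleR_left)
      then show ?thesis
        using primitive_on_diff[OF F xy] primitive_on_diff[OF A_prim xy] by simp
    qed
    finally have "D y - D x =
        integral {x..y} (\<lambda>t. A y *\<^sub>R f t) + integral {x..y} (\<lambda>t. A' t *\<^sub>R F x) - integral {x..y} ?g"
      unfolding D_def using int_combine[OF absolutely_integrable_onD(1)[OF g]]
      by (simp add: algebra_simps)
    also have "\<dots> = integral {x..y} (\<lambda>t. A y *\<^sub>R f t + A' t *\<^sub>R F x - ?g t)"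
      using i1 i2 i3 by (simp add: integral_add integral_diff integrable_add)
    also have "norm \<dots> \<le> integral {x..y} (\<lambda>t. L * (y - x) * norm (f t) + L * N)"
    proof (rule integral_norm_bound_integral)
      show "(\<lambda>t. A y *\<^sub>R f t + A' t *\<^sub>R F x - ?g t) integrable_on {x..y}"
        by (intro integrable_diff integrable_add i1 i2 i3)
      show "(\<lambda>t. L * (y - x) * norm (f t) + L * N) integrable_on {x..y}"
        using absolutely_integrable_onD(2)[OF abs_xy[OF f]]
        by (intro integrable_add integrable_on_mult_right) auto
      fix t assume t: "t \<in> {x..y}"
      have "norm (A y - A t) = norm (integral {t..y} A')"
        using primitive_on_diff[OF A_prim, of t y] t xy by simp
      also have "\<dots> \<le> integral {t..y} (\<lambda>_. L)"
        using t xy by (intro integral_norm_bound_integral integrable_continuous_real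
            continuous_on_subset[OF A'] L[unfolded real_norm_def[symmetric]]) auto
      also have "\<dots> \<le> L * (y - x)"
        using t \<open>L \<ge> 0\<close> by (simp add: mult.commute mult_left_mono)
      finally have 1: "\<bar>A y - A t\<bar> \<le> L * (y - x)" by simp
      have "norm (F t - F x) = norm (integral {x..t} f)"
        using primitive_on_diff[OF F, of x t] t xy by simp
      also have "\<dots> \<le> integral {x..t} (\<lambda>t. norm (f t))"
        using t xy by (intro integral_norm_bound_integral absolutely_integrable_onD
          absolutely_integrable_on_subinterval[OF f]) auto
      also have "\<dots> \<le> N"
        unfolding N_def using t xy by (intro integral_subset_le absolutely_integrable_onD
          absolutely_integrable_on_subinterval[OF f]) auto
      finally have 2: "norm (F t - F x) \<le> N" .
      have "A y *\<^sub>R f t + A' t *\<^sub>R F x - ?g t = (A y - A t) *\<^sub>R f t - A' t *\<^sub>R (F t - F x)"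
        by (simp add: algebra_simps)
      also have "norm \<dots> \<le> \<bar>A y - A t\<bar> * norm (f t) + \<bar>A' t\<bar> * norm (F t - F x)"
        by (metis norm_scaleR norm_triangle_ineq4)
      also have "\<dots> \<le> L * (y - x) * norm (f t) + L * N"
        using 1 2 L[of t] t sub \<open>L \<ge> 0\<close> by (intro add_mono mult_mono) auto
      finally show "norm (A y *\<^sub>R f t + A' t *\<^sub>R F x - ?g t) \<le> L * (y - x) * norm (f t) + L * N" .
    qed
    also have "\<dots> = (y - x) * (2 * L * N)"
    proof -
      have "integral {x..y} (\<lambda>t. L * (y - x) * norm (f t) + L * N) = L * (y - x) * N + (y - x) * (L * N)"
        using absolutely_integrable_onD(2)[OF abs_xy[OF f]] xy
        by (subst integral_add) (simp_all add: N_def integrable_on_mult_right integrable_continuous_real)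
      then show ?thesis by (simp add: algebra_simps)
    qed
    finally show "norm (D y - D x) \<le> (y - x) * \<bar>G y - G x\<bar>"
      unfolding N using \<open>L \<ge> 0\<close> \<open>N \<ge> 0\<close> by simp
  qed (use that in auto)
  moreover have "D a = 0"
    by (simp add: D_def)
  ultimately have "A x *\<^sub>R F x - A a *\<^sub>R F a - integral {a..x} ?g = 0" if "x \<in> {a..b}" for x
    using that unfolding D_def[symmetric] by (simp only:)
  then have "A x *\<^sub>R F x = A a *\<^sub>R F a + integral {a..x} ?g" if "x \<in> {a..b}" for x
    using that by (simp only: diff_diff_eq right_minus_eq)
  then show ?thesis
    using g unfolding primitive_on_def by blast
qed

lemma integral_by_parts_primitive:
  fixes F :: "real \<Rightarrow> 'a::euclidean_space"
  assumes F: "primitive_on a b F f" and "a \<le> b"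
    and A: "\<And>x. x \<in> {a..b} \<Longrightarrow> (A has_real_derivative A' x) (at x within {a..b})"
    and A': "continuous_on {a..b} A'"
  shows "integral {a..b} (\<lambda>x. A' x *\<^sub>R F x) =
     A b *\<^sub>R F b - A a *\<^sub>R F a - integral {a..b} (\<lambda>x. A x *\<^sub>R f x)"
proof -
  have Ac: "continuous_on {a..b} A"
    by (rule DERIV_continuous_on[OF A])
  have "A b *\<^sub>R F b - A a *\<^sub>R F a = integral {a..b} (\<lambda>x. A' x *\<^sub>R F x + A x *\<^sub>R f x)"
    using primitive_on_diff[OF primitive_on_scaleR[OF F A A']] assms(2) by simp
  also have "\<dots> = integral {a..b} (\<lambda>x. A' x *\<^sub>R F x) + integral {a..b} (\<lambda>x. A x *\<^sub>R f x)"
  proof (rule integral_add)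
    show "(\<lambda>x. A' x *\<^sub>R F x) integrable_on {a..b}"
      by (intro integrable_continuous_real continuous_intros A' primitive_on_continuous[OF F])
    show "(\<lambda>x. A x *\<^sub>R f x) integrable_on {a..b}"
      using F by (intro absolutely_integrable_onD absolutely_integrable_scaleR_continuous Ac)
        (simp add: primitive_on_def)
  qed
  finally show ?thesis by simp
qed

subsection \<open>Weak derivatives on an interval\<close>

lemma AE_lebesgue_on_iff_negligible:
  fixes S :: "'a::euclidean_space set"
  assumes "S \<in> sets lebesgue"
  shows "(AE x in lebesgue_on S. P x) \<longleftrightarrow> negligible {x \<in> S. \<not> P x}"
proof -
  have "(AE x in lebesgue_on S. P x) \<longleftrightarrow> (AE x in lebesgue. x \<in> S \<longrightarrow> P x)"
    using assms by (intro AE_restrict_space_iff) auto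
  also have "\<dots> \<longleftrightarrow> negligible {x \<in> S. \<not> P x}"
    unfolding eventually_ae_filter negligible_iff_null_sets
    by (auto simp: Int_def intro: null_sets_completion_subset)
  finally show ?thesis .
qed

lemma integral_eq_if_zero_outside:
  fixes f :: "'a::euclidean_space \<Rightarrow> 'b::banach"
  assumes "\<And>x. x \<in> S - T \<Longrightarrow> f x = 0" "\<And>x. x \<in> T - S \<Longrightarrow> f x = 0"
  shows "integral S f = integral T f"
proof (rule integral_spike_set)
  show "negligible {x \<in> S - T. f x \<noteq> 0}" "negligible {x \<in> T - S. f x \<noteq> 0}"
    using assms by (metis (mono_tags, lifting) empty_Collect_eq negligible_empty)+
qed

lemma integrable_lebesgue_on_iff:
  fixes f :: "'a::euclidean_space \<Rightarrow> 'b::euclidean_space"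
  assumes "S \<in> sets lebesgue"
  shows "integrable (lebesgue_on S) f \<longleftrightarrow> f absolutely_integrable_on S"
  using assms by (simp add: integrable_restrict_space set_integrable_def)

lemma absolutely_integrable_on_open_interval_real:
  fixes f :: "real \<Rightarrow> 'a::euclidean_space"
  shows "f absolutely_integrable_on {a<..<b} \<longleftrightarrow> f absolutely_integrable_on {a..b}"
  using absolutely_integrable_on_open_interval[where f = f and a = a and b = b] by simp

lemma LINT_open_interval_eq_integral:
  fixes f :: "real \<Rightarrow> 'a::euclidean_space"
  assumes "f absolutely_integrable_on {a..b}"
  shows "(LINT x|lebesgue_on {a<..<b}. f x) = integral {a..b} f"
  using assms by (simp add: lebesgue_integral_eq_integral integrable_lebesgue_on_iff
      absolutely_integrable_on_open_interval_real integral_open_interval_real)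

lemma locally_integrableD:
  assumes "locally_integrable a b f" "a < c" "d < b"
  shows "f absolutely_integrable_on {c..d}"
proof -
  have "integrable (lebesgue_on {c..d}) f"
    using assms unfolding locally_integrable_def by (auto simp: subset_eq)
  then show ?thesis
    by (simp add: integrable_lebesgue_on_iff)
qed

lemma locally_integrableI:
  assumes "f absolutely_integrable_on {a..b}"
  shows "locally_integrable a b f"
  unfolding locally_integrable_def
proof (intro allI impI)
  fix K :: "real set"
  assume K: "compact K" "K \<subseteq> {a<..<b}"
  then have "K \<in> sets lebesgue"
    by (simp add: borel_compact sets_completionI_sets)
  moreover have "f absolutely_integrable_on K"
    by (rule set_integrable_subset[OF assms]) (use K calculation in auto)
  ultimately show "integrable (lebesgue_on K) f"
    by (simp add: integrable_lebesgue_on_iff)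
qed

lemma locally_integrable_diff:
  assumes "locally_integrable a b f" "locally_integrable a b g"
  shows "locally_integrable a b (\<lambda>x. f x - g x)"
  using assms unfolding locally_integrable_def by auto

lemma test_function_deriv:
  assumes "test_function a b \<phi>"
  shows "test_function a b (deriv \<phi>)"
proof -
  obtain c d where cd: "smooth \<phi>" "a < c" "d < b" "\<And>x. x \<notin> {c..d} \<Longrightarrow> \<phi> x = 0"
    using test_functionD[OF assms] by metis
  have "deriv \<phi> x = 0" if "x \<notin> {c..d}" for x
  proof -
    have "\<forall>\<^sub>F y in nhds x. y \<in> - {c..d}"
      using that by (intro eventually_nhds_in_open) auto
    then have "\<forall>\<^sub>F y in nhds x. \<phi> y = 0"
      by eventually_elim (use cd in auto)
    then have "deriv \<phi> x = deriv (\<lambda>_. 0) x"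
      by (rule deriv_cong_ev) simp
    then show ?thesis by simp
  qed
  then show ?thesis
    using cd by (intro test_functionI[OF smooth_deriv]) auto
qed

lemma test_function_scaleR_integrable:
  assumes "test_function a b \<phi>" "locally_integrable a b f"
  shows "(\<lambda>x. \<phi> x *\<^sub>R f x) absolutely_integrable_on {a..b}"
proof -
  obtain c d where cd: "smooth \<phi>" "a < c" "d < b" "\<And>x. x \<notin> {c..d} \<Longrightarrow> \<phi> x = 0"
    using test_functionD[OF assms(1)] by metis
  have int: "(\<lambda>x. \<phi> x *\<^sub>R f x) absolutely_integrable_on {c..d}"
    by (intro absolutely_integrable_scaleR_continuous smooth_continuous_on cd
        locally_integrableD[OF assms(2)])
  have *: "{x \<in> {c..d} - {a..b}. \<phi> x *\<^sub>R f x \<noteq> 0} = {}"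
    "{x \<in> {a..b} - {c..d}. \<phi> x *\<^sub>R f x \<noteq> 0} = {}"
    using cd by auto
  have "negligible {x \<in> {c..d} - {a..b}. \<phi> x *\<^sub>R f x \<noteq> 0}"
    "negligible {x \<in> {a..b} - {c..d}. \<phi> x *\<^sub>R f x \<noteq> 0}"
    unfolding * by simp_all
  from absolutely_integrable_spike_set_eq[OF this] int show ?thesis
    by blast
qed

text \<open>A test function makes both integrands absolutely integrable up to the endpoints, even
  for \<open>f\<close> and \<open>g\<close> that are only locally integrable, so the two notions of
  integral agree.\<close>

lemma has_weak_deriv_1_iff:
  "has_weak_deriv 1 a b f g \<longleftrightarrow> locally_integrable a b f \<and> locally_integrable a b g \<and>
     (\<forall>\<phi>. test_function a b \<phi> \<longrightarrow>
       integral {a..b} (\<lambda>x. deriv \<phi> x *\<^sub>R f x) = - integral {a..b} (\<lambda>x. \<phi> x *\<^sub>R g x))"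
  unfolding has_weak_deriv_def
  by (auto simp: LINT_open_interval_eq_integral test_function_scaleR_integrable test_function_deriv)

text \<open>\<open>sobolev_H\<close> supplies the second weak derivative of \<open>f\<close>
  directly, not as a derivative of \<open>f1\<close>. The link comes from testing the first-order
  identity with \<open>deriv \<phi>\<close>.\<close>

lemma has_weak_deriv_2_imp_1:
  assumes "has_weak_deriv 1 a b f f1" "has_weak_deriv 2 a b f f2"
  shows "has_weak_deriv 1 a b f1 f2"
  unfolding has_weak_deriv_1_iff
proof (intro conjI allI impI)
  fix \<phi> assume \<phi>: "test_function a b \<phi>"
  have loc: "locally_integrable a b f" "locally_integrable a b f1" "locally_integrable a b f2"
    using assms by (auto simp: has_weak_deriv_def)
  have "(deriv ^^ 2) \<phi> = deriv (deriv \<phi>)"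
    by (simp add: numeral_2_eq_2)
  then have "integral {a..b} (\<lambda>x. deriv (deriv \<phi>) x *\<^sub>R f x) = integral {a..b} (\<lambda>x. \<phi> x *\<^sub>R f2 x)"
    using assms(2) \<phi> loc unfolding has_weak_deriv_def
    by (auto simp: LINT_open_interval_eq_integral test_function_scaleR_integrable test_function_deriv)
  moreover have "integral {a..b} (\<lambda>x. deriv (deriv \<phi>) x *\<^sub>R f x) = - integral {a..b} (\<lambda>x. deriv \<phi> x *\<^sub>R f1 x)"
    using assms(1) test_function_deriv[OF \<phi>] unfolding has_weak_deriv_1_iff by blast
  ultimately show "integral {a..b} (\<lambda>x. deriv \<phi> x *\<^sub>R f1 x) = - integral {a..b} (\<lambda>x. \<phi> x *\<^sub>R f2 x)"
    by (metis minus_minus)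
qed (use assms in \<open>auto simp: has_weak_deriv_def\<close>)

section \<open>The fundamental lemma of the calculus of variations and the du Bois-Reymond
  lemma\<close>

lemma bump_zero: "x \<notin> {c<..<d} \<Longrightarrow> bump c d n x = 0"
  using bump_pos_iff[of c d n x] bump_bounds[of c d n x] by linarith

lemma test_function_bump: "a < c \<Longrightarrow> d < b \<Longrightarrow> test_function a b (bump c d n)"
  by (intro test_functionI[OF smooth_bump, of a c d]) (auto intro: bump_zero)

text \<open>The bumps on \<open>{c<..<d}\<close> are test functions converging to its indicator, and
  \<open>norm (h x)\<close> dominates the integrands.\<close>

lemma integral_zero_if_orthogonal_to_tests:
  assumes loc: "locally_integrable a b h"
    and zero: "\<And>\<phi>. test_function a b \<phi> \<Longrightarrow> integral {a..b} (\<lambda>x. \<phi> x *\<^sub>R h x) = 0"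
    and cd: "a < c" "d < b"
  shows "integral {c..d} h = 0"
proof -
  have h: "h absolutely_integrable_on {c..d}"
    by (rule locally_integrableD[OF loc cd])
  have "(\<lambda>n. integral {c..d} (\<lambda>x. bump c d n x *\<^sub>R h x)) \<longlonglongrightarrow>
      integral {c..d} (\<lambda>x. indicator {c<..<d} x *\<^sub>R h x)"
  proof (rule dominated_convergence(2))
    show "(\<lambda>x. bump c d n x *\<^sub>R h x) integrable_on {c..d}" for n
      by (intro absolutely_integrable_onD absolutely_integrable_scaleR_continuous
          smooth_continuous_on smooth_bump h)
    show "norm (bump c d n x *\<^sub>R h x) \<le> norm (h x)" for n x
      using bump_bounds[of c d n x] by (simp add: mult_left_le_one_le)
    show "(\<lambda>n. bump c d n x *\<^sub>R h x) \<longlonglongrightarrow> indicator {c<..<d} x *\<^sub>R h x" for x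
      by (intro tendsto_intros bump_tendsto)
  qed (use absolutely_integrable_onD(2)[OF h] in auto)
  moreover have "integral {c..d} (\<lambda>x. bump c d n x *\<^sub>R h x) = 0" for n
  proof -
    have "integral {c..d} (\<lambda>x. bump c d n x *\<^sub>R h x) = integral {a..b} (\<lambda>x. bump c d n x *\<^sub>R h x)"
      using cd by (intro integral_eq_if_zero_outside) (auto intro: bump_zero)
    then show ?thesis
      using zero[OF test_function_bump[OF cd]] by simp
  qed
  moreover have "integral {c..d} (\<lambda>x. indicator {c<..<d} x *\<^sub>R h x) = integral {c..d} h"
    by (rule integral_spike[of "{c, d}"]) auto
  ultimately show ?thesis
    by (simp add: LIMSEQ_const_iff)
qed

text \<open>All integrals of \<open>h\<close> over compact subintervals vanish, so by Lebesgue
  differentiation \<open>h\<close> vanishes almost everywhere.\<close>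

lemma negligible_if_orthogonal_to_tests:
  assumes loc: "locally_integrable a b h"
    and zero: "\<And>\<phi>. test_function a b \<phi> \<Longrightarrow> integral {a..b} (\<lambda>x. \<phi> x *\<^sub>R h x) = 0"
  shows "negligible {x \<in> {a<..<b}. h x \<noteq> 0}"
proof -
  have neg: "negligible {x \<in> {c<..<d}. h x \<noteq> 0}" if cd: "a < c" "d < b" for c d
  proof -
    \<comment> \<open>The differentiation theorem asks for integrability on every box, which the
      cut-off function has although \<open>h\<close> is only locally integrable.\<close>
    define h0 where "h0 x = (if x \<in> {c..d} then h x else 0)" for x
    have h0: "h0 integrable_on cbox p q" for p q
    proof -
      have "h integrable_on {c..d}"
        by (intro absolutely_integrable_onD locally_integrableD[OF loc cd])
      then have "h0 integrable_on UNIV"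
        unfolding h0_def by (simp only: integrable_restrict_UNIV)
      then show ?thesis
        by (rule integrable_on_subcbox) auto
    qed
    obtain N where N: "negligible N" "\<And>x e. x \<notin> N \<Longrightarrow> 0 < e \<Longrightarrow> \<exists>\<delta>>0. \<forall>t. 0 < t \<and> t < \<delta> \<longrightarrow>
        norm (integral (cbox x (x + t *\<^sub>R One)) h0 /\<^sub>R t ^ DIM(real) - h0 x) < e"
      using integrable_ccontinuous_explicit[OF h0] by metis
    have "h x = 0" if x: "x \<in> {c<..<d}" "x \<notin> N" for x
    proof (rule ccontr)
      assume "h x \<noteq> 0"
      then have "norm (h x) > 0" by simp
      from N(2)[OF x(2) this] obtain \<delta> where \<delta>: "\<delta> > 0" "\<And>t. 0 < t \<and> t < \<delta> \<Longrightarrow>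
          norm (integral {x..x + t} h0 /\<^sub>R t - h0 x) < norm (h x)"
        by auto
      \<comment> \<open>Small enough for the estimate and for \<open>{x..x + t}\<close> to stay
        inside \<open>{c..d}\<close>; there the averaged integral is 0, and the estimate would read
        \<open>norm (h x) < norm (h x)\<close>.\<close>
      define t where "t = min (\<delta> / 2) (d - x)"
      have t: "0 < t" "t < \<delta>" "x + t \<le> d"
        using \<delta>(1) x by (auto simp: t_def min_def field_simps)
      have "integral {x..x + t} h0 = integral {x..x + t} h"
        using t x by (intro integral_cong) (auto simp: h0_def)
      also have "\<dots> = 0"
        using t x cd by (intro integral_zero_if_orthogonal_to_tests[OF loc zero]) auto
      finally show False
        using \<delta>(2)[of t] t x by (auto simp: h0_def)
    qed
    then show ?thesis
      by (intro negligible_subset[OF N(1)]) auto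
  qed
  \<comment> \<open>The open interval is exhausted by countably many subintervals that stay away
    from its endpoints.\<close>
  define I where "I n = {x \<in> {a + inverse (real (Suc n))<..<b - inverse (real (Suc n))}. h x \<noteq> 0}" for n
  have "negligible (\<Union>n. I n)"
    unfolding I_def by (intro negligible_Union_nat neg) auto
  moreover have "{x \<in> {a<..<b}. h x \<noteq> 0} \<subseteq> (\<Union>n. I n)"
  proof
    fix x assume x: "x \<in> {x \<in> {a<..<b}. h x \<noteq> 0}"
    then obtain n where "inverse (real (Suc n)) < min (x - a) (b - x)"
      using reals_Archimedean[of "min (x - a) (b - x)"] by auto
    then have "x \<in> I n"
      using x by (auto simp: I_def)
    then show "x \<in> (\<Union>n. I n)" by blast
  qed
  ultimately show ?thesis
    by (rule negligible_subset)
qed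

lemma has_weak_deriv_1_unique:
  assumes "has_weak_deriv 1 a b f g" "has_weak_deriv 1 a b f g'"
  shows "negligible {x \<in> {a<..<b}. g x \<noteq> g' x}"
proof -
  have loc: "locally_integrable a b g" "locally_integrable a b g'"
    using assms by (auto simp: has_weak_deriv_def)
  have "negligible {x \<in> {a<..<b}. g x - g' x \<noteq> 0}"
  proof (rule negligible_if_orthogonal_to_tests[OF locally_integrable_diff[OF loc]])
    fix \<phi> assume \<phi>: "test_function a b \<phi>"
    have "integral {a..b} (\<lambda>x. deriv \<phi> x *\<^sub>R f x) = - integral {a..b} (\<lambda>x. \<phi> x *\<^sub>R g x)"
      "integral {a..b} (\<lambda>x. deriv \<phi> x *\<^sub>R f x) = - integral {a..b} (\<lambda>x. \<phi> x *\<^sub>R g' x)"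
      using assms \<phi> unfolding has_weak_deriv_1_iff by blast+
    then have "integral {a..b} (\<lambda>x. \<phi> x *\<^sub>R g x) = integral {a..b} (\<lambda>x. \<phi> x *\<^sub>R g' x)"
      by simp
    then show "integral {a..b} (\<lambda>x. \<phi> x *\<^sub>R (g x - g' x)) = 0"
      using test_function_scaleR_integrable[OF \<phi>] loc
      by (simp add: scaleR_diff_right integral_diff absolutely_integrable_onD)
  qed
  then show ?thesis by simp
qed

text \<open>The indefinite integral is constant to the right of the support, and the constant is the
  total integral; mean zero is what makes the support compact again.\<close>

lemma test_function_antideriv:
  assumes \<theta>: "test_function a b \<theta>" and int: "integral {a..b} \<theta> = 0"
  obtains \<eta> where "test_function a b \<eta>" "deriv \<eta> = \<theta>"
proof -
  obtain c d where cd: "smooth \<theta>" "a < c" "d < b" "\<And>x. x \<notin> {c..d} \<Longrightarrow> \<theta> x = 0"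
    using test_functionD[OF \<theta>] by metis
  define \<eta> where "\<eta> x = integral {a..x} \<theta>" for x
  have cont: "continuous_on A \<theta>" for A
    by (rule smooth_continuous_on[OF cd(1)])
  have low: "\<eta> x = 0" if "x < c" for x
    using integral_eq_if_zero_outside[of "{a..x}" "{}" \<theta>] that cd by (simp add: \<eta>_def)
  have high: "\<eta> x = 0" if "x > d" for x
  \<comment> \<open>\<open>d\<close> may lie below \<open>a\<close>; for \<open>x < a\<close> the
    integral runs over an empty interval and is 0.\<close>
  proof (cases "a \<le> x")
    case True
    have "integral {a..x} \<theta> = integral {a..b} \<theta>"
    proof (cases "x \<le> b")
      case True
      then show ?thesis
        using cd that by (intro integral_eq_if_zero_outside) auto
    next
      case False
      then have "integral {a..b} \<theta> = integral {a..x} \<theta>"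
        using cd that by (intro integral_eq_if_zero_outside) auto
      then show ?thesis by simp
    qed
    then show ?thesis using int by (simp add: \<eta>_def)
  qed (simp add: \<eta>_def)
  have der: "(\<eta> has_real_derivative \<theta> x) (at x)" for x
  proof (cases "x < c")
    case True
    then have "\<forall>\<^sub>F y in nhds x. y \<in> {..<c}"
      by (intro eventually_nhds_in_open) auto
    then have "\<forall>\<^sub>F y in nhds x. \<eta> y = 0"
      by eventually_elim (use low in auto)
    then show ?thesis
      using cd(4)[of x] True by (subst DERIV_cong_ev[where g = "\<lambda>_. 0"]) auto
  next
    case False
    then have "x \<in> {a<..<x + 1}" using cd by auto
    then have "(\<eta> has_real_derivative \<theta> x) (at x within {a..x + 1})"
      unfolding \<eta>_def by (intro integral_has_real_derivative cont) auto
    then show ?thesis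
      using \<open>x \<in> {a<..<x + 1}\<close> by (simp add: at_within_Icc_at)
  qed
  show ?thesis
  proof
    show "test_function a b \<eta>"
      using cd low high by (intro test_functionI[OF smooth_antideriv[OF der]]) force+
    show "deriv \<eta> = \<theta>"
      by (rule deriv_eqI[OF der])
  qed
qed

text \<open>Derivatives of test functions are the test functions of mean zero. Subtracting a
  multiple of a fixed \<open>\<psi>\<close> gives any test function mean zero, which reduces the
  claim to the fundamental lemma for \<open>f - k\<close>.\<close>

lemma du_Bois_Reymond:
  assumes "a < b" and loc: "locally_integrable a b f"
    and zero: "\<And>\<phi>. test_function a b \<phi> \<Longrightarrow> integral {a..b} (\<lambda>x. deriv \<phi> x *\<^sub>R f x) = 0"
  obtains k where "negligible {x \<in> {a<..<b}. f x \<noteq> k}"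
proof -
  define c d where "c = (2 * a + b) / 3" and "d = (a + 2 * b) / 3"
  have cd: "a < c" "c < d" "d < b"
    using assms(1) by (auto simp: c_def d_def)
  define \<psi> where "\<psi> = bump c d 0"
  have \<psi>: "test_function a b \<psi>" "smooth \<psi>"
    unfolding \<psi>_def using cd by (auto intro: test_function_bump smooth_bump)
  have cont: "continuous_on {a..b} \<psi>"
    by (rule smooth_continuous_on[OF \<psi>(2)])
  define J where "J = integral {a..b} \<psi>"
  have "J \<noteq> 0"
  proof
    assume "J = 0"
    then have "\<psi> ((c + d) / 2) = 0"
      using integral_eq_0_iff[OF cont] cd bump_bounds unfolding J_def \<psi>_def by auto
    then show False
      using bump_pos_iff[of c d 0 "(c + d) / 2"] cd unfolding \<psi>_def by auto
  qed
  \<comment> \<open>The only possible constant: testing \<open>f = k\<close> against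
    \<open>\<psi>\<close> forces this weighted mean.\<close>
  define k where "k = integral {a..b} (\<lambda>x. \<psi> x *\<^sub>R f x) /\<^sub>R J"
  have loc_k: "locally_integrable a b (\<lambda>_. k)"
    by (intro locally_integrableI absolutely_integrable_continuous_real continuous_intros)
  have "negligible {x \<in> {a<..<b}. f x - k \<noteq> 0}"
  proof (rule negligible_if_orthogonal_to_tests[OF locally_integrable_diff[OF loc loc_k]])
    fix \<phi> assume \<phi>: "test_function a b \<phi>"
    \<comment> \<open>Chosen so that \<open>\<phi>\<close> minus \<open>r\<close> times
      \<open>\<psi>\<close> has integral zero and is therefore the derivative of a test
      function.\<close>
    define r where "r = integral {a..b} \<phi> / J"
    define \<theta> where "\<theta> x = \<phi> x + - r * \<psi> x" for x
    obtain p q where pq: "smooth \<phi>" "a < p" "q < b" "\<And>x. x \<notin> {p..q} \<Longrightarrow> \<phi> x = 0"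
      using test_functionD[OF \<phi>] by metis
    have \<theta>: "test_function a b \<theta>"
    proof (rule test_functionI)
      show "smooth \<theta>"
        unfolding \<theta>_def by (intro smooth_add smooth_cmult pq \<psi>)
      show "a < min p c" "max q d < b" using pq cd by auto
      show "\<theta> x = 0" if "x \<notin> {min p c..max q d}" for x
      proof -
        have "x \<notin> {p..q}" "x \<notin> {c<..<d}"
          using that by auto
        then show ?thesis
          using pq(4)[of x] bump_zero[of x c d 0] by (simp add: \<theta>_def \<psi>_def)
      qed
    qed
    have \<phi>i: "\<phi> integrable_on {a..b}" and \<psi>i: "\<psi> integrable_on {a..b}"
      by (intro integrable_continuous_real smooth_continuous_on pq \<psi>)+
    have "integral {a..b} \<theta> = integral {a..b} \<phi> + - r * J"
      unfolding \<theta>_def J_def using \<phi>i \<psi>i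
      by (subst integral_add) (simp_all add: integrable_on_mult_right integrable_neg)
    also have "\<dots> = 0"
      using \<open>J \<noteq> 0\<close> by (simp add: r_def)
    finally obtain \<eta> where \<eta>: "test_function a b \<eta>" "deriv \<eta> = \<theta>"
      using test_function_antideriv[OF \<theta>] by blast
    note \<phi>f = absolutely_integrable_onD(1)[OF test_function_scaleR_integrable[OF \<phi> loc]]
    note \<psi>f = absolutely_integrable_onD(1)[OF test_function_scaleR_integrable[OF \<psi>(1) loc]]
    have "0 = integral {a..b} (\<lambda>x. \<theta> x *\<^sub>R f x)"
      using zero[OF \<eta>(1)] \<eta>(2) by simp
    also have "\<dots> = integral {a..b} (\<lambda>x. \<phi> x *\<^sub>R f x - r *\<^sub>R (\<psi> x *\<^sub>R f x))"
      by (simp add: \<theta>_def algebra_simps)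
    also have "\<dots> = integral {a..b} (\<lambda>x. \<phi> x *\<^sub>R f x) - r *\<^sub>R integral {a..b} (\<lambda>x. \<psi> x *\<^sub>R f x)"
      using integral_diff[OF \<phi>f integrable_cmul[OF \<psi>f, of r]] by (simp only: integral_cmul)
    finally have "integral {a..b} (\<lambda>x. \<phi> x *\<^sub>R f x) = r *\<^sub>R integral {a..b} (\<lambda>x. \<psi> x *\<^sub>R f x)"
      by (simp only: eq_commute[of 0] right_minus_eq)
    also have "\<dots> = integral {a..b} \<phi> *\<^sub>R k"
      by (simp add: k_def r_def divide_inverse)
    also have "\<dots> = integral {a..b} (\<lambda>x. \<phi> x *\<^sub>R k)"
      using integral_linear[OF \<phi>i bounded_linear_scaleR_left[of k]] by (simp add: o_def)
    finally show "integral {a..b} (\<lambda>x. \<phi> x *\<^sub>R (f x - k)) = 0"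
      using \<phi>f absolutely_integrable_onD(1)[OF test_function_scaleR_integrable[OF \<phi> loc_k]]
      by (simp add: scaleR_diff_right integral_diff)
  qed
  then show ?thesis
    by (intro that[of k]) simp
qed

section \<open>Weak derivatives and indefinite integrals coincide\<close>

lemma primitive_on_imp_has_weak_deriv:
  assumes F: "primitive_on a b F g" and "a \<le> b" and neg: "negligible {x \<in> {a<..<b}. f x \<noteq> F x}"
  shows "has_weak_deriv 1 a b f g"
  unfolding has_weak_deriv_1_iff
proof (intro conjI allI impI)
  show "locally_integrable a b g"
    by (rule locally_integrableI[OF primitive_onD(1)[OF F]])
  have neg': "negligible (insert a (insert b {x \<in> {a<..<b}. f x \<noteq> F x}))"
    using neg by simp
  have "F absolutely_integrable_on {a..b}"
    by (intro absolutely_integrable_continuous_real primitive_on_continuous[OF F])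
  then have "f absolutely_integrable_on {a..b}"
    by (rule absolutely_integrable_spike[OF _ neg']) auto
  then show "locally_integrable a b f"
    by (rule locally_integrableI)
  fix \<phi> assume \<phi>: "test_function a b \<phi>"
  obtain c d where cd: "smooth \<phi>" "a < c" "d < b" "\<And>x. x \<notin> {c..d} \<Longrightarrow> \<phi> x = 0"
    using test_functionD[OF \<phi>] by metis
  have "integral {a..b} (\<lambda>x. deriv \<phi> x *\<^sub>R f x) = integral {a..b} (\<lambda>x. deriv \<phi> x *\<^sub>R F x)"
    by (rule integral_spike[OF neg']) auto
  also have "\<dots> = \<phi> b *\<^sub>R F b - \<phi> a *\<^sub>R F a - integral {a..b} (\<lambda>x. \<phi> x *\<^sub>R g x)"
    using has_field_derivative_at_within[OF smooth_has_real_derivative[OF cd(1)]]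
    by (intro integral_by_parts_primitive[OF F assms(2)] smooth_continuous_on smooth_deriv cd)
  also have "\<dots> = - integral {a..b} (\<lambda>x. \<phi> x *\<^sub>R g x)"
    using cd by simp
  finally show "integral {a..b} (\<lambda>x. deriv \<phi> x *\<^sub>R f x) = - integral {a..b} (\<lambda>x. \<phi> x *\<^sub>R g x)" .
qed

text \<open>The indefinite integral \<open>G\<close> of \<open>g\<close> has the same weak
  derivative as \<open>f\<close>, so \<open>f - G\<close> is almost everywhere constant.\<close>

lemma has_weak_deriv_imp_primitive_on:
  assumes w: "has_weak_deriv 1 a b f g" and "a < b" and g: "g absolutely_integrable_on {a..b}"
  obtains F where "primitive_on a b F g" "negligible {x \<in> {a<..<b}. f x \<noteq> F x}"
proof -
  define G where "G x = integral {a..x} g" for x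
  have G: "primitive_on a b G g"
    using g by (simp add: primitive_on_def G_def)
  have wG: "has_weak_deriv 1 a b G g"
    using G assms(2) by (intro primitive_on_imp_has_weak_deriv) auto
  have loc: "locally_integrable a b f" "locally_integrable a b G"
    using w wG by (auto simp: has_weak_deriv_def)
  obtain k where k: "negligible {x \<in> {a<..<b}. f x - G x \<noteq> k}"
  proof (rule du_Bois_Reymond[OF assms(2) locally_integrable_diff[OF loc]])
    fix \<phi> assume \<phi>: "test_function a b \<phi>"
    then have "integral {a..b} (\<lambda>x. deriv \<phi> x *\<^sub>R f x) = integral {a..b} (\<lambda>x. deriv \<phi> x *\<^sub>R G x)"
      using w wG unfolding has_weak_deriv_1_iff by metis
    then show "integral {a..b} (\<lambda>x. deriv \<phi> x *\<^sub>R (f x - G x)) = 0"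
      using test_function_scaleR_integrable[OF test_function_deriv[OF \<phi>]] loc
      by (simp add: scaleR_diff_right integral_diff absolutely_integrable_onD)
  qed
  show ?thesis
  proof
    show "primitive_on a b (\<lambda>x. k + G x) g"
      using g by (simp add: primitive_on_def G_def)
    show "negligible {x \<in> {a<..<b}. f x \<noteq> k + G x}"
      by (rule negligible_subset[OF k]) (auto simp: algebra_simps)
  qed
qed

subsection \<open>Functions with vanishing weighted mean\<close>

lemma Cauchy_Schwarz_integral:
  fixes f g :: "'a::euclidean_space \<Rightarrow> real"
  assumes f: "(\<lambda>x. (f x)\<^sup>2) integrable_on S" and g: "(\<lambda>x. (g x)\<^sup>2) integrable_on S"
    and fg: "(\<lambda>x. f x * g x) integrable_on S"
  shows "(integral S (\<lambda>x. f x * g x))\<^sup>2 \<le> integral S (\<lambda>x. (f x)\<^sup>2) * integral S (\<lambda>x. (g x)\<^sup>2)"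
proof -
  define A B C where "A = integral S (\<lambda>x. (f x)\<^sup>2)" and "B = integral S (\<lambda>x. f x * g x)"
    and "C = integral S (\<lambda>x. (g x)\<^sup>2)"
  have quad: "0 \<le> A * s\<^sup>2 - 2 * s * B + C" for s
  proof -
    have "((\<lambda>x. s\<^sup>2 * (f x)\<^sup>2 - 2 * s * (f x * g x) + (g x)\<^sup>2) has_integral (s\<^sup>2 * A - 2 * s * B + C)) S"
      unfolding A_def B_def C_def using assms
      by (intro has_integral_add has_integral_diff has_integral_mult_right integrable_integral)
    moreover have "0 \<le> s\<^sup>2 * (f x)\<^sup>2 - 2 * s * (f x * g x) + (g x)\<^sup>2" for x
    proof -
      have "s\<^sup>2 * (f x)\<^sup>2 - 2 * s * (f x * g x) + (g x)\<^sup>2 = (s * f x - g x)\<^sup>2"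
        by (simp add: power2_eq_square algebra_simps)
      then show ?thesis by simp
    qed
    ultimately have "0 \<le> s\<^sup>2 * A - 2 * s * B + C"
      by (rule has_integral_nonneg)
    then show ?thesis by (simp add: mult.commute)
  qed
  have "A \<ge> 0"
    unfolding A_def by (rule integral_nonneg[OF f]) simp
  have "B\<^sup>2 \<le> A * C"
  proof (cases "A = 0")
    case True
    have "B = 0"
    proof (rule ccontr)
      assume "B \<noteq> 0"
      \<comment> \<open>For \<open>A = 0\<close> the quadratic is affine in \<open>s\<close>, and
        this \<open>s\<close> gives it the value -1.\<close>
      with quad[of "(C + 1) / (2 * B)"] True show False
        by (simp add: field_simps)
    qed
    then show ?thesis using True by simp
  next
    case False
    then have "A > 0" using \<open>A \<ge> 0\<close> by simp
    \<comment> \<open>\<open>B / A\<close> is the minimiser of the quadratic.\<close>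
    have "0 \<le> A * (A * (B / A)\<^sup>2 - 2 * (B / A) * B + C)"
      using quad[of "B / A"] \<open>A > 0\<close> by simp
    also have "\<dots> = A * C - B\<^sup>2"
      using False by (simp add: field_simps power2_eq_square)
    finally show ?thesis by simp
  qed
  then show ?thesis by (simp add: A_def B_def C_def)
qed

lemma integral_scaleR_norm_integrable:
  fixes f :: "real \<Rightarrow> 'a::euclidean_space"
  assumes "f absolutely_integrable_on {a..b}" "continuous_on {a..b} A"
  shows "(\<lambda>t. A t * norm (f t)) integrable_on {a..b}"
  using absolutely_integrable_scaleR_continuous[OF assms(2) absolutely_integrable_norm[OF assms(1)]]
  by (simp add: absolutely_integrable_onD o_def)

text \<open>Cauchy-Schwarz after writing t^m as t^(m-s) t^s. The bound \<open>M\<close> is left open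
  because it comes from integrability at 0 for small intervals near 0 and from
  \<open>b powr (- 2 * s)\<close> for intervals beyond 1.\<close>

lemma integral_powr_mult_norm_le:
  fixes f :: "real \<Rightarrow> 'a::euclidean_space"
  assumes "0 < a" and f: "f absolutely_integrable_on {a..b}"
    and f2: "(\<lambda>t. (norm (f t))\<^sup>2) integrable_on {a..b}"
    and M: "integral {a..b} (\<lambda>t. t powr (2 * m - 2 * s)) \<le> M"
  shows "integral {a..b} (\<lambda>t. t powr m * norm (f t)) \<le>
    sqrt M * sqrt (integral {a..b} (\<lambda>t. (norm (f t))\<^sup>2 * t powr (2 * s)))"
proof -
  let ?h = "integral {a..b} (\<lambda>t. (norm (f t))\<^sup>2 * t powr (2 * s))"
  have cont: "continuous_on {a..b} (\<lambda>t. t powr e)" for e :: real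
    using assms(1) by (intro continuous_intros) auto
  have eq1: "(t powr (m - s))\<^sup>2 = t powr (2 * m - 2 * s)" if "t \<in> {a..b}" for t
    using that assms(1) by (simp add: powr_powr[symmetric] powr_power algebra_simps)
  have eq2: "(t powr s * norm (f t))\<^sup>2 = (norm (f t))\<^sup>2 * t powr (2 * s)" if "t \<in> {a..b}" for t
    using that assms(1) by (simp add: power_mult_distrib powr_power algebra_simps)
  have eq3: "t powr (m - s) * (t powr s * norm (f t)) = t powr m * norm (f t)" for t
    by (simp add: mult.assoc[symmetric] powr_add[symmetric])
  have f2': "(\<lambda>t. (norm (f t))\<^sup>2 * t powr (2 * s)) integrable_on {a..b}"
  proof -
    have "(\<lambda>t. (norm (f t))\<^sup>2) absolutely_integrable_on {a..b}"
      using f2 by (subst absolutely_integrable_on_iff_nonneg) auto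
    from absolutely_integrable_onD(1)[OF absolutely_integrable_scaleR_continuous[OF cont[of "2 * s"] this]]
    show ?thesis by (simp add: mult.commute)
  qed
  have "(integral {a..b} (\<lambda>t. t powr (m - s) * (t powr s * norm (f t))))\<^sup>2 \<le>
      integral {a..b} (\<lambda>t. (t powr (m - s))\<^sup>2) * integral {a..b} (\<lambda>t. (t powr s * norm (f t))\<^sup>2)"
  proof (rule Cauchy_Schwarz_integral)
    show "(\<lambda>t. (t powr (m - s))\<^sup>2) integrable_on {a..b}"
      by (intro integrable_continuous_real continuous_on_power cont)
    show "(\<lambda>t. (t powr s * norm (f t))\<^sup>2) integrable_on {a..b}"
      using f2' by (rule integrable_eq) (simp add: eq2)
    show "(\<lambda>t. t powr (m - s) * (t powr s * norm (f t))) integrable_on {a..b}"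
      unfolding eq3 by (intro integral_scaleR_norm_integrable f cont)
  qed
  also have "\<dots> = integral {a..b} (\<lambda>t. t powr (2 * m - 2 * s)) * ?h"
    by (intro arg_cong2[where f = "(*)"] integral_cong eq1 eq2)
  also have "\<dots> \<le> M * ?h"
    using M f2' by (intro mult_right_mono integral_nonneg) auto
  finally have "integral {a..b} (\<lambda>t. t powr m * norm (f t)) \<le> sqrt (M * ?h)"
    unfolding eq3 by (rule real_le_rsqrt)
  then show ?thesis by (simp add: real_sqrt_mult)
qed

text \<open>Enlarging the interval to \<open>{0..c}\<close> makes the bound independent of
  \<open>a\<close>; this is where exponents above -1 enter.\<close>

lemma integral_powr_le:
  assumes "0 < a" "b \<le> c" "e > (-1::real)"
  shows "integral {a..b} (\<lambda>t. t powr e) \<le> c powr (e + 1) / (e + 1)"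
proof (cases "a \<le> b")
  case True
  have "((\<lambda>t. t powr e) has_integral c powr (e + 1) / (e + 1)) {0..c}"
    using assms True by (intro has_integral_powr_from_0) auto
  moreover have "continuous_on {a..b} (\<lambda>t. t powr e)"
    using assms(1) by (intro continuous_intros) auto
  ultimately show ?thesis
    using assms True
    by (intro has_integral_subset_le[of "{a..b}" "{0..c}" "\<lambda>t. t powr e"] integrable_integral
        integrable_continuous_real) auto
next
  case False
  then show ?thesis using assms(3) by simp
qed

text \<open>Integration by parts on each side of \<open>x\<close>, with a primitive of
  \<open>\<rho>\<close> that vanishes at the outer end: \<open>R\<close> on \<open>{a..x}\<close>
  and \<open>R - R b\<close> on \<open>{x..b}\<close>. Only boundary terms at \<open>x\<close>
  survive, and they add up to \<open>R b *\<^sub>R F x\<close>.\<close>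

lemma weighted_mean_zero_bound:
  fixes F :: "real \<Rightarrow> 'a::euclidean_space"
  assumes F: "primitive_on a b F f"
    and \<rho>: "continuous_on {a..b} \<rho>" "\<And>t. t \<in> {a..b} \<Longrightarrow> \<rho> t \<ge> 0"
    and zero: "integral {a..b} (\<lambda>t. \<rho> t *\<^sub>R F t) = 0"
    and x: "a \<le> x" "x \<le> b"
  defines "R \<equiv> \<lambda>t. integral {a..t} \<rho>"
  shows "R b * norm (F x) \<le>
    integral {a..x} (\<lambda>t. R t * norm (f t)) + R b * integral {x..b} (\<lambda>t. norm (f t))"
proof -
  have R: "(R has_real_derivative \<rho> t) (at t within {a..b})" if "t \<in> {a..b}" for t
    unfolding R_def using that by (intro integral_has_real_derivative \<rho>)
  have Rc: "continuous_on {a..b} R"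
    by (rule DERIV_continuous_on[OF R])
  have sub: "{a..x} \<subseteq> {a..b}" "{x..b} \<subseteq> {a..b}"
    using x by auto
  have R_mono: "0 \<le> R t" "R t \<le> R b" if "t \<in> {a..b}" for t
    unfolding R_def using that \<rho>
    by (auto intro!: integral_nonneg integral_subset_le integrable_continuous_real
        intro: continuous_on_subset)
  have f: "f absolutely_integrable_on {a..b}"
    by (rule primitive_onD(1)[OF F])
  note f1 = absolutely_integrable_on_subinterval[OF f sub(1)]
  note f2 = absolutely_integrable_on_subinterval[OF f sub(2)]
  have 1: "integral {a..x} (\<lambda>t. \<rho> t *\<^sub>R F t) = R x *\<^sub>R F x - R a *\<^sub>R F a - integral {a..x} (\<lambda>t. R t *\<^sub>R f t)"
    using x sub by (intro integral_by_parts_primitive primitive_on_subinterval[OF F]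
        continuous_on_subset[OF \<rho>(1)] DERIV_subset[OF R]) auto
  have "R a = 0"
    by (simp add: R_def)
  have 2: "integral {x..b} (\<lambda>t. \<rho> t *\<^sub>R F t) =
      (R b - R b) *\<^sub>R F b - (R x - R b) *\<^sub>R F x - integral {x..b} (\<lambda>t. (R t - R b) *\<^sub>R f t)"
  proof (rule integral_by_parts_primitive)
    show "((\<lambda>t. R t - R b) has_real_derivative \<rho> t) (at t within {x..b})" if "t \<in> {x..b}" for t
      using DERIV_diff[OF DERIV_subset[OF R sub(2)] DERIV_const[of "R b"], of t] that x by simp
  qed (use x sub in \<open>auto intro: primitive_on_subinterval[OF F] continuous_on_subset[OF \<rho>(1)]\<close>)
  have 3: "integral {a..x} (\<lambda>t. \<rho> t *\<^sub>R F t) + integral {x..b} (\<lambda>t. \<rho> t *\<^sub>R F t) = 0"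
    unfolding zero[symmetric] using x
    by (intro Henstock_Kurzweil_Integration.integral_combine integrable_continuous_real
        continuous_intros \<rho> primitive_on_continuous[OF F])
  have "R b *\<^sub>R F x = (integral {a..x} (\<lambda>t. \<rho> t *\<^sub>R F t) + integral {x..b} (\<lambda>t. \<rho> t *\<^sub>R F t)) +
      integral {a..x} (\<lambda>t. R t *\<^sub>R f t) + integral {x..b} (\<lambda>t. (R t - R b) *\<^sub>R f t)"
    unfolding 1 2 \<open>R a = 0\<close> by (simp add: algebra_simps)
  also note 3
  finally have "R b *\<^sub>R F x =
      integral {a..x} (\<lambda>t. R t *\<^sub>R f t) + integral {x..b} (\<lambda>t. (R t - R b) *\<^sub>R f t)"
    by simp
  then have "R b * norm (F x) = norm (integral {a..x} (\<lambda>t. R t *\<^sub>R f t) +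
      integral {x..b} (\<lambda>t. (R t - R b) *\<^sub>R f t))"
    using R_mono(1)[of b] x by (metis abs_of_nonneg atLeastAtMost_iff norm_scaleR order_refl order_trans)
  also have "\<dots> \<le> norm (integral {a..x} (\<lambda>t. R t *\<^sub>R f t)) +
      norm (integral {x..b} (\<lambda>t. (R t - R b) *\<^sub>R f t))"
    by (rule norm_triangle_ineq)
  also have "\<dots> \<le> integral {a..x} (\<lambda>t. R t * norm (f t)) + integral {x..b} (\<lambda>t. R b * norm (f t))"
  proof (rule add_mono; rule integral_norm_bound_integral)
    show "(\<lambda>t. R t *\<^sub>R f t) integrable_on {a..x}"
      by (intro absolutely_integrable_onD absolutely_integrable_scaleR_continuous
          continuous_on_subset[OF Rc] sub f1)
    show "(\<lambda>t. R t * norm (f t)) integrable_on {a..x}"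
      by (intro integral_scaleR_norm_integrable continuous_on_subset[OF Rc] sub f1)
    show "(\<lambda>t. (R t - R b) *\<^sub>R f t) integrable_on {x..b}"
      by (intro absolutely_integrable_onD absolutely_integrable_scaleR_continuous
          continuous_intros continuous_on_subset[OF Rc] sub f2)
    show "(\<lambda>t. R b * norm (f t)) integrable_on {x..b}"
      by (intro integral_scaleR_norm_integrable continuous_intros f2)
    show "norm (R t *\<^sub>R f t) \<le> R t * norm (f t)" if "t \<in> {a..x}" for t
      using R_mono(1)[of t] that sub by auto
    show "norm ((R t - R b) *\<^sub>R f t) \<le> R b * norm (f t)" if "t \<in> {x..b}" for t
      unfolding norm_scaleR using R_mono[of t] that sub by (intro mult_right_mono) auto
  qed
  finally show ?thesis by simp
qed

text \<open>Since \<open>R t \<le> R b\<close>, the normalised kernel is at most 1 on both sides of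
  \<open>x\<close>.\<close>

lemma mean_zero_bound:
  fixes F :: "real \<Rightarrow> 'a::euclidean_space"
  assumes F: "primitive_on a b F f" and "0 < a" "a < b"
    and zero: "integral {a..b} (\<lambda>t. (t powr e) *\<^sub>R F t) = 0"
    and x: "a \<le> x" "x \<le> b"
  shows "norm (F x) \<le> integral {a..b} (\<lambda>t. norm (f t))"
proof -
  define R where "R t = integral {a..t} (\<lambda>t. t powr e)" for t
  have cont: "continuous_on A (\<lambda>t. t powr e)" if "A \<subseteq> {a..b}" for A
    using assms(2) that by (intro continuous_intros) auto
  have R_mono: "R t \<le> R b" if "t \<in> {a..b}" for t
    unfolding R_def using that
    by (intro integral_subset_le integrable_continuous_real cont) auto
  have "R b > 0"
  proof -
    have "R b \<noteq> 0"
      using integral_eq_0_iff[OF cont[OF order_refl]] assms(2,3) unfolding R_def by fastforce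
    moreover have "R b \<ge> 0"
      unfolding R_def by (intro integral_nonneg integrable_continuous_real cont) auto
    ultimately show ?thesis by simp
  qed
  have f: "f absolutely_integrable_on {a..b}"
    by (rule primitive_onD(1)[OF F])
  note f1 = absolutely_integrable_on_subinterval[OF f, of a x]
  have Rc: "continuous_on {a..x} R"
    unfolding R_def using x
    by (intro indefinite_integral_continuous_1 integrable_continuous_real cont) auto
  have "R b * norm (F x) \<le>
      integral {a..x} (\<lambda>t. R t * norm (f t)) + R b * integral {x..b} (\<lambda>t. norm (f t))"
    unfolding R_def using x zero
    by (intro weighted_mean_zero_bound[OF F] cont) auto
  also have "integral {a..x} (\<lambda>t. R t * norm (f t)) \<le> integral {a..x} (\<lambda>t. R b * norm (f t))"
    using x by (intro integral_le integral_scaleR_norm_integrable f1 Rc continuous_intros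
        mult_right_mono R_mono) auto
  also have "\<dots> + R b * integral {x..b} (\<lambda>t. norm (f t)) =
      R b * (integral {a..x} (\<lambda>t. norm (f t)) + integral {x..b} (\<lambda>t. norm (f t)))"
    by (simp add: distrib_left)
  also have "\<dots> = R b * integral {a..b} (\<lambda>t. norm (f t))"
    using x absolutely_integrable_onD(2)[OF f]
    by (subst Henstock_Kurzweil_Integration.integral_combine) auto
  finally show ?thesis
    using \<open>R b > 0\<close> by simp
qed

text \<open>Left of \<open>x\<close> the normalised kernel is at most a constant times t^(2p+1), and
  x^q \<le> 2^q. Right of \<open>x\<close> it is at most 1, and x^q \<le> t^q moves the weight under
  the integral. The constants do not depend on \<open>a\<close>.\<close>

lemma mean_zero_powr_bound:
  fixes F :: "real \<Rightarrow> 'a::euclidean_space"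
  assumes F: "primitive_on a (a + 1) F f" and a: "0 < a" "a \<le> 1" and pq: "p \<ge> 0" "q \<ge> 0"
    and zero: "integral {a..a + 1} (\<lambda>t. (t powr (2 * p)) *\<^sub>R F t) = 0"
    and x: "a \<le> x" "x \<le> a + 1"
  shows "x powr q * norm (F x) \<le>
    2 powr (q + 2 * p + 1) * integral {a..a + 1} (\<lambda>t. t powr (2 * p + 1) * norm (f t)) +
    integral {a..a + 1} (\<lambda>t. t powr q * norm (f t))"
proof -
  define R where "R t = integral {a..t} (\<lambda>t. t powr (2 * p))" for t
  have cont: "continuous_on A (\<lambda>t. t powr e)" if "A \<subseteq> {a..a + 1}" for A e
    using a that by (intro continuous_intros) auto
  have R_le: "R t \<le> t powr (2 * p + 1)" if "t \<in> {a..a + 1}" for t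
  proof -
    have "R t \<le> integral {a..t} (\<lambda>_. t powr (2 * p))"
      unfolding R_def using that a pq
      by (intro integral_le integrable_continuous_real cont powr_mono2) auto
    also have "\<dots> = (t - a) * t powr (2 * p)"
      using that by simp
    also have "\<dots> \<le> t * t powr (2 * p)"
      using a by (intro mult_right_mono) auto
    also have "\<dots> = t powr (2 * p + 1)"
      using that a by (simp add: powr_add mult.commute)
    finally show ?thesis .
  qed
  \<comment> \<open>The right half of the interval stays at distance at least 1/2 from 0, so the
    total mass has a lower bound uniform in \<open>a\<close>.\<close>
  have R_ge: "R (a + 1) \<ge> (1 / 2) powr (2 * p + 1)"
  proof -
    have "(1 / 2) powr (2 * p + 1) = integral {a + 1 / 2..a + 1} (\<lambda>_. (1 / 2) powr (2 * p))"
      by (simp add: powr_add)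
    also have "\<dots> \<le> integral {a + 1 / 2..a + 1} (\<lambda>t. t powr (2 * p))"
      using a pq by (intro integral_le integrable_continuous_real cont powr_mono2) auto
    also have "\<dots> \<le> R (a + 1)"
      unfolding R_def using a by (intro integral_subset_le integrable_continuous_real cont) auto
    finally show ?thesis .
  qed
  have half: "(1 / 2::real) powr (2 * p + 1) * 2 powr (2 * p + 1) = 1"
    by (simp add: powr_mult[symmetric])
  have "R (a + 1) > 0"
    by (rule less_le_trans[OF _ R_ge]) simp
  have ratio: "R t \<le> R (a + 1) * (2 powr (2 * p + 1) * t powr (2 * p + 1))" if "t \<in> {a..a + 1}" for t
  proof -
    have "1 \<le> R (a + 1) * 2 powr (2 * p + 1)"
      using mult_right_mono[OF R_ge, of "2 powr (2 * p + 1)"] half by simp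
    from mult_right_mono[OF this, of "t powr (2 * p + 1)"] R_le[OF that] show ?thesis
      by (simp add: mult.assoc)
  qed
  have f: "f absolutely_integrable_on {a..a + 1}"
    by (rule primitive_onD(1)[OF F])
  have f': "f absolutely_integrable_on {c..d}" if "a \<le> c" "d \<le> a + 1" for c d
    using that by (intro absolutely_integrable_on_subinterval[OF f]) auto
  have Rc: "continuous_on {a..x} R"
    unfolding R_def using x
    by (intro indefinite_integral_continuous_1 integrable_continuous_real cont) auto
  define I J where "I = integral {a..a + 1} (\<lambda>t. t powr (2 * p + 1) * norm (f t))"
    and "J = integral {a..a + 1} (\<lambda>t. t powr q * norm (f t))"
  have "R (a + 1) * norm (F x) \<le>
      integral {a..x} (\<lambda>t. R t * norm (f t)) + R (a + 1) * integral {x..a + 1} (\<lambda>t. norm (f t))"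
    unfolding R_def using x zero
    by (intro weighted_mean_zero_bound[OF F] cont) auto
  also have "integral {a..x} (\<lambda>t. R t * norm (f t)) \<le> integral {a..x}
      (\<lambda>t. R (a + 1) * (2 powr (2 * p + 1) * t powr (2 * p + 1)) * norm (f t))"
    using x by (intro integral_le integral_scaleR_norm_integrable f' Rc continuous_intros cont
        mult_right_mono ratio) auto
  also have "\<dots> = R (a + 1) * (2 powr (2 * p + 1) * integral {a..x} (\<lambda>t. t powr (2 * p + 1) * norm (f t)))"
    by (simp add: mult.assoc)
  finally have "R (a + 1) * norm (F x) \<le> R (a + 1) *
      (2 powr (2 * p + 1) * integral {a..x} (\<lambda>t. t powr (2 * p + 1) * norm (f t)) +
        integral {x..a + 1} (\<lambda>t. norm (f t)))"
    by (simp add: distrib_left)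
  then have Fx: "norm (F x) \<le> 2 powr (2 * p + 1) * integral {a..x} (\<lambda>t. t powr (2 * p + 1) * norm (f t)) +
      integral {x..a + 1} (\<lambda>t. norm (f t))"
    using \<open>R (a + 1) > 0\<close> by simp
  have I: "integral {a..x} (\<lambda>t. t powr (2 * p + 1) * norm (f t)) \<le> I"
    unfolding I_def using x
    by (intro integral_subset_le integral_scaleR_norm_integrable f' cont) auto
  have "I \<ge> 0"
    unfolding I_def by (intro integral_nonneg integral_scaleR_norm_integrable f cont) auto
  have "x powr q * integral {x..a + 1} (\<lambda>t. norm (f t)) = integral {x..a + 1} (\<lambda>t. x powr q * norm (f t))"
    by simp
  also have "\<dots> \<le> integral {x..a + 1} (\<lambda>t. t powr q * norm (f t))"
    using x a pq by (intro integral_le integral_scaleR_norm_integrable f' continuous_intros cont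
        mult_right_mono powr_mono2) auto
  also have "\<dots> \<le> J"
    unfolding J_def using x
    by (intro integral_subset_le integral_scaleR_norm_integrable f' cont) auto
  finally have J: "x powr q * integral {x..a + 1} (\<lambda>t. norm (f t)) \<le> J" .
  have "x powr q * norm (F x) \<le> x powr q * (2 powr (2 * p + 1) * I + integral {x..a + 1} (\<lambda>t. norm (f t)))"
    using order_trans[OF Fx add_right_mono[OF mult_left_mono[OF I]]] by (intro mult_left_mono) auto
  also have "\<dots> = x powr q * (2 powr (2 * p + 1) * I) + x powr q * integral {x..a + 1} (\<lambda>t. norm (f t))"
    by (rule distrib_left)
  also have "\<dots> \<le> 2 powr q * (2 powr (2 * p + 1) * I) + J"
    using x a pq J \<open>I \<ge> 0\<close> by (intro add_mono mult_right_mono powr_mono2) auto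
  also have "2 powr q * (2 powr (2 * p + 1) * I) = 2 powr (q + 2 * p + 1) * I"
    by (simp add: powr_add mult_ac)
  finally show ?thesis by (simp add: I_def J_def)
qed

section \<open>The pointwise estimate, free of weak derivatives\<close>

text \<open>Collects what the estimates use about u: \<open>V\<close> is u / x^\<beta>,
  \<open>W\<close> is V' / x^\<alpha>, and the last two clauses are the constraints rewritten for
  them. Square integrability of \<open>W'\<close> is what Cauchy-Schwarz requires.\<close>

definition admissible ::
    "real \<Rightarrow> real \<Rightarrow> real \<Rightarrow> (real \<Rightarrow> 'a::euclidean_space) \<Rightarrow> (real \<Rightarrow> 'a) \<Rightarrow> (real \<Rightarrow> 'a) \<Rightarrow> bool" where
  "admissible \<alpha> \<beta> b V W W' \<longleftrightarrow>
     primitive_on b (b + 1) W W' \<and> primitive_on b (b + 1) V (\<lambda>t. t powr \<alpha> *\<^sub>R W t) \<and>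
     (\<lambda>t. (norm (W' t))\<^sup>2) integrable_on {b..b + 1} \<and>
     integral {b..b + 1} (\<lambda>t. t powr (2 * \<alpha>) *\<^sub>R W t) = 0 \<and>
     integral {b..b + 1} (\<lambda>t. t powr (2 * \<beta>) *\<^sub>R V t) = 0"

definition energy :: "real \<Rightarrow> real \<Rightarrow> (real \<Rightarrow> 'a::euclidean_space) \<Rightarrow> real" where
  "energy \<sigma> b W' = integral {b..b + 1} (\<lambda>t. (norm (W' t))\<^sup>2 * t powr (2 * \<sigma>))"

lemma energy_nonneg: "energy \<sigma> b W' \<ge> 0"
  unfolding energy_def
  \<comment> \<open>Without integrability the integral takes its default value 0, which is still
    nonnegative.\<close>
  by (cases "(\<lambda>t. (norm (W' t))\<^sup>2 * t powr (2 * \<sigma>)) integrable_on {b..b + 1}")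
    (auto intro: integral_nonneg simp: not_integrable_integral)

text \<open>As \<open>y \<le> b + 1 \<le> 2 * b\<close>, only powers of \<open>b\<close> have to be
  counted: -(\<alpha>+\<beta>) from Cauchy-Schwarz, \<alpha> from V' and \<beta>-\<gamma> from the
  prefactor, in total -\<gamma> \<le> 0.\<close>

lemma admissible_bound_large:
  assumes adm: "admissible \<alpha> \<beta> b V W W'" and "b \<ge> 1"
    and par: "\<alpha> \<ge> 0" "0 \<le> \<gamma>" "\<gamma> \<le> \<beta>" and y: "y \<in> {b..b + 1}"
  shows "y powr (\<beta> - \<gamma>) * norm (V y) \<le> 2 powr (\<alpha> + \<beta>) * sqrt (energy (\<alpha> + \<beta>) b W')"
proof -
  let ?\<sigma> = "\<alpha> + \<beta>"
  let ?h = "sqrt (energy ?\<sigma> b W')"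
  note adm' = adm[unfolded admissible_def]
  have W: "primitive_on b (b + 1) W W'" and V: "primitive_on b (b + 1) V (\<lambda>t. t powr \<alpha> *\<^sub>R W t)"
    using adm' by auto
  have W': "W' absolutely_integrable_on {b..b + 1}"
    by (rule primitive_onD(1)[OF W])
  have cont: "continuous_on {b..b + 1} (\<lambda>t. t powr e)" for e :: real
    using assms(2) by (intro continuous_intros) auto
  have Wx: "norm (W x) \<le> b powr - ?\<sigma> * ?h" if "x \<in> {b..b + 1}" for x
  proof -
    have "norm (W x) \<le> integral {b..b + 1} (\<lambda>t. norm (W' t))"
      using that adm' assms(2) by (intro mean_zero_bound[OF W, where e = "2 * \<alpha>"]) auto
    also have "\<dots> = integral {b..b + 1} (\<lambda>t. t powr 0 * norm (W' t))"
      using assms(2) by (intro integral_cong) auto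
    also have "\<dots> \<le> sqrt (b powr (- 2 * ?\<sigma>)) * ?h"
      unfolding energy_def
    proof (rule integral_powr_mult_norm_le[OF _ W'])
      have "integral {b..b + 1} (\<lambda>t. t powr (2 * 0 - 2 * ?\<sigma>)) \<le> integral {b..b + 1} (\<lambda>_. b powr (- 2 * ?\<sigma>))"
        using assms(2) par by (intro integral_le integrable_continuous_real cont) (auto intro: powr_mono2')
      then show "integral {b..b + 1} (\<lambda>t. t powr (2 * 0 - 2 * ?\<sigma>)) \<le> b powr (- 2 * ?\<sigma>)"
        by simp
    qed (use adm' assms(2) in auto)
    also have "sqrt (b powr (- 2 * ?\<sigma>)) = b powr - ?\<sigma>"
    proof -
      have "b powr (- 2 * ?\<sigma>) = (b powr - ?\<sigma>)\<^sup>2"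
        by (simp add: power2_eq_square powr_add[symmetric])
      then show ?thesis by simp
    qed
    finally show ?thesis .
  qed
  have h: "?h \<ge> 0"
    by (simp add: energy_nonneg)
  have Wc: "continuous_on {b..b + 1} (\<lambda>t. norm (t powr \<alpha> *\<^sub>R W t))"
    by (intro continuous_intros cont primitive_on_continuous[OF W])
  have "norm (V y) \<le> integral {b..b + 1} (\<lambda>t. norm (t powr \<alpha> *\<^sub>R W t))"
    using y adm' assms(2) by (intro mean_zero_bound[OF V, where e = "2 * \<beta>"]) auto
  also have "\<dots> \<le> integral {b..b + 1} (\<lambda>_. (2 * b) powr \<alpha> * (b powr - ?\<sigma> * ?h))"
  proof (rule integral_le[OF integrable_continuous_real[OF Wc]])
    fix t assume t: "t \<in> {b..b + 1}"
    then have "\<bar>t powr \<alpha>\<bar> \<le> (2 * b) powr \<alpha>"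
      using assms(2) par by (auto intro: powr_mono2)
    then show "norm (t powr \<alpha> *\<^sub>R W t) \<le> (2 * b) powr \<alpha> * (b powr - ?\<sigma> * ?h)"
      unfolding norm_scaleR using Wx[OF t] by (intro mult_mono) auto
  qed (intro integrable_continuous_real continuous_intros)
  also have "\<dots> = (2 * b) powr \<alpha> * (b powr - ?\<sigma> * ?h)"
    by simp
  finally have Vy: "norm (V y) \<le> (2 * b) powr \<alpha> * (b powr - ?\<sigma> * ?h)" .
  have "y powr (\<beta> - \<gamma>) * norm (V y) \<le> (2 * b) powr (\<beta> - \<gamma>) * ((2 * b) powr \<alpha> * (b powr - ?\<sigma> * ?h))"
    using y assms(2) par Vy by (intro mult_mono powr_mono2) auto
  also have "\<dots> = 2 powr (?\<sigma> - \<gamma>) * (b powr - \<gamma>) * ?h"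
    proof -
    have "(2 * b) powr (\<beta> - \<gamma>) * (2 * b) powr \<alpha> * b powr - ?\<sigma> = (2 * b) powr (?\<sigma> - \<gamma>) * b powr - ?\<sigma>"
      unfolding powr_add[symmetric] by (simp add: algebra_simps)
    also have "\<dots> = 2 powr (?\<sigma> - \<gamma>) * (b powr (?\<sigma> - \<gamma>) * b powr - ?\<sigma>)"
      using assms(2) by (simp add: powr_mult)
    also have "b powr (?\<sigma> - \<gamma>) * b powr - ?\<sigma> = b powr - \<gamma>"
      by (simp add: powr_add[symmetric])
    finally show ?thesis
      by (simp only: mult.assoc[symmetric])
  qed
  also have "\<dots> \<le> 2 powr ?\<sigma> * 1 * ?h"
    using assms(2) par h by (intro mult_right_mono mult_mono powr_mono) (auto simp: powr_minus inverse_le_1_iff ge_one_powr_ge_zero)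
  finally show ?thesis by simp
qed

text \<open>\<open>mean_zero_powr_bound\<close> is used twice: for \<open>W\<close> with p =
  \<alpha>, q = \<delta>, and for \<open>V\<close> with p = \<beta>, q = \<beta> - \<gamma>.\<close>

lemma admissible_bound_small:
  assumes par: "\<alpha> \<ge> 0" "0 \<le> \<gamma>" "\<gamma> \<le> \<beta>" "\<gamma> < 3 / 2" "\<beta> < 3 / 2 + \<alpha>"
  obtains C where "C > 0"
    "\<And>b V W (W'::real \<Rightarrow> 'a::euclidean_space) y. admissible \<alpha> \<beta> b V W W' \<Longrightarrow> 0 < b \<Longrightarrow> b \<le> 1 \<Longrightarrow> y \<in> {b..b + 1} \<Longrightarrow>
       y powr (\<beta> - \<gamma>) * norm (V y) \<le> C * sqrt (energy (\<alpha> + \<beta>) b W')"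
proof -
  define \<sigma> where "\<sigma> = \<alpha> + \<beta>"
  \<comment> \<open>The midpoint of the interval \<open>(\<sigma> - 1/2, \<sigma> - \<gamma> + 1)\<close>: its lower end makes \<open>t powr (2 * \<delta> - 2 * \<sigma>)\<close>
    integrable at 0, its upper end makes \<open>t powr (\<sigma> - \<gamma> - \<delta>)\<close> integrable at 0.\<close>
  define \<delta> where "\<delta> = \<sigma> + 1 / 4 - \<gamma> / 2"
  \<comment> \<open>The integral of t^e over \<open>{0..2}\<close>, which contains
    \<open>{b..b + 1}\<close> for every \<open>b\<close> in question.\<close>
  define M where "M e = 2 powr (e + 1) / (e + 1)" for e :: real
  \<comment> \<open>In \<open>D\<^sub>1\<close> and \<open>D\<^sub>2\<close> the first summand
    belongs to the kernel left of the evaluation point, the second to its right. The factor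
    2^(\<beta>+\<gamma>+1) in \<open>D\<^sub>2\<close> bounds the excess of t^(2\<beta>+1+\<alpha>)
    over t^(\<sigma>-\<gamma>).\<close>
  define D\<^sub>1 where "D\<^sub>1 = 2 powr (\<delta> + 2 * \<alpha> + 1) * sqrt (M (2 * \<alpha> + 2 - 2 * \<beta>)) + sqrt (M (2 * \<delta> - 2 * \<sigma>))"
  define D\<^sub>2 where "D\<^sub>2 = 2 powr ((\<beta> - \<gamma>) + 2 * \<beta> + 1) * 2 powr (\<beta> + \<gamma> + 1) + 1"
  define D\<^sub>3 where "D\<^sub>3 = M (\<sigma> - \<gamma> - \<delta>)"
  have exps: "2 * \<alpha> + 2 - 2 * \<beta> > -1" "2 * \<delta> - 2 * \<sigma> > -1" "\<sigma> - \<gamma> - \<delta> > -1" "\<delta> \<ge> 0"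
    using par by (auto simp: \<delta>_def \<sigma>_def)
  have M_pos: "M e > 0" if "e > -1" for e
    using that by (simp add: M_def)
  have M_le: "integral {b..b + 1} (\<lambda>t. t powr e) \<le> M e" if "0 < b" "b \<le> 1" "e > -1" for b e :: real
    unfolding M_def using that by (intro integral_powr_le) auto
  have pos: "D\<^sub>1 > 0" "D\<^sub>2 > 0" "D\<^sub>3 > 0"
    unfolding D\<^sub>1_def D\<^sub>2_def D\<^sub>3_def using M_pos exps by (auto intro!: add_pos_pos)
  show thesis
  proof
    show "D\<^sub>1 * D\<^sub>2 * D\<^sub>3 > 0"
      using pos by simp
    fix b y :: real and V W W' :: "real \<Rightarrow> 'a"
    assume adm: "admissible \<alpha> \<beta> b V W W'" and b: "0 < b" "b \<le> 1" and y: "y \<in> {b..b + 1}"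
    let ?h = "sqrt (energy \<sigma> b W')"
    note adm' = adm[unfolded admissible_def]
    have W: "primitive_on b (b + 1) W W'" and V: "primitive_on b (b + 1) V (\<lambda>t. t powr \<alpha> *\<^sub>R W t)"
      using adm' by auto
    have W': "W' absolutely_integrable_on {b..b + 1}"
      by (rule primitive_onD(1)[OF W])
    have cont: "continuous_on {b..b + 1} (\<lambda>t. t powr e)" for e :: real
      using b by (intro continuous_intros) auto
    note Wc = primitive_on_continuous[OF W]
    have cs: "integral {b..b + 1} (\<lambda>t. t powr m * norm (W' t)) \<le> sqrt (M (2 * m - 2 * \<sigma>)) * ?h"
      if "2 * m - 2 * \<sigma> > -1" for m
      unfolding energy_def using adm' b that
      by (intro integral_powr_mult_norm_le W' M_le) auto
    have Wx: "x powr \<delta> * norm (W x) \<le> D\<^sub>1 * ?h" if "x \<in> {b..b + 1}" for x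
    proof -
      have "x powr \<delta> * norm (W x) \<le>
          2 powr (\<delta> + 2 * \<alpha> + 1) * integral {b..b + 1} (\<lambda>t. t powr (2 * \<alpha> + 1) * norm (W' t)) +
          integral {b..b + 1} (\<lambda>t. t powr \<delta> * norm (W' t))"
        using that adm' b exps par by (intro mean_zero_powr_bound[OF W]) auto
      also have "\<dots> \<le> 2 powr (\<delta> + 2 * \<alpha> + 1) * (sqrt (M (2 * (2 * \<alpha> + 1) - 2 * \<sigma>)) * ?h) +
          sqrt (M (2 * \<delta> - 2 * \<sigma>)) * ?h"
        using exps by (intro add_mono mult_left_mono cs) (auto simp: \<sigma>_def)
      also have "2 * (2 * \<alpha> + 1) - 2 * \<sigma> = 2 * \<alpha> + 2 - 2 * \<beta>"
        by (simp add: \<sigma>_def)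
      finally show ?thesis
        by (simp add: D\<^sub>1_def algebra_simps)
    qed
    define I where "I = integral {b..b + 1} (\<lambda>t. t powr (\<sigma> - \<gamma>) * norm (W t))"
    have I1: "integral {b..b + 1} (\<lambda>t. t powr (2 * \<beta> + 1) * norm (t powr \<alpha> *\<^sub>R W t)) \<le> 2 powr (\<beta> + \<gamma> + 1) * I"
    proof -
      have "integral {b..b + 1} (\<lambda>t. t powr (2 * \<beta> + 1) * norm (t powr \<alpha> *\<^sub>R W t)) \<le>
          integral {b..b + 1} (\<lambda>t. 2 powr (\<beta> + \<gamma> + 1) * (t powr (\<sigma> - \<gamma>) * norm (W t)))"
      proof (intro integral_le integrable_continuous_real continuous_on_mult continuous_on_norm
          continuous_on_scaleR continuous_on_const cont Wc)
        fix t assume t: "t \<in> {b..b + 1}"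
        have "t powr (2 * \<beta> + 1) * norm (t powr \<alpha> *\<^sub>R W t) = t powr (\<beta> + \<gamma> + 1) * (t powr (\<sigma> - \<gamma>) * norm (W t))"
        proof -
          have "t powr (2 * \<beta> + 1) * t powr \<alpha> = t powr (\<beta> + \<gamma> + 1) * t powr (\<sigma> - \<gamma>)"
            unfolding powr_add[symmetric] by (simp add: \<sigma>_def algebra_simps)
          then show ?thesis
            by (simp add: mult.assoc[symmetric])
        qed
        also have "\<dots> \<le> 2 powr (\<beta> + \<gamma> + 1) * (t powr (\<sigma> - \<gamma>) * norm (W t))"
          using t b par by (intro mult_right_mono powr_mono2) auto
        finally show "t powr (2 * \<beta> + 1) * norm (t powr \<alpha> *\<^sub>R W t) \<le>
          2 powr (\<beta> + \<gamma> + 1) * (t powr (\<sigma> - \<gamma>) * norm (W t))" .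
      qed
      then show ?thesis by (simp add: I_def)
    qed
    have I2: "integral {b..b + 1} (\<lambda>t. t powr (\<beta> - \<gamma>) * norm (t powr \<alpha> *\<^sub>R W t)) = I"
    proof -
      have "t powr (\<beta> - \<gamma>) * t powr \<alpha> = t powr (\<sigma> - \<gamma>)" for t
        unfolding powr_add[symmetric] by (simp add: \<sigma>_def algebra_simps)
      then show ?thesis
        unfolding I_def by (simp add: mult.assoc[symmetric])
    qed
    have I3: "I \<le> D\<^sub>1 * ?h * D\<^sub>3"
    proof -
      have "I \<le> integral {b..b + 1} (\<lambda>t. D\<^sub>1 * ?h * t powr (\<sigma> - \<gamma> - \<delta>))"
        unfolding I_def
      proof (intro integral_le integrable_continuous_real continuous_on_mult continuous_on_norm
          continuous_on_scaleR continuous_on_const cont Wc)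
        fix t assume t: "t \<in> {b..b + 1}"
        have "t powr (\<sigma> - \<gamma>) * norm (W t) = t powr (\<sigma> - \<gamma> - \<delta>) * (t powr \<delta> * norm (W t))"
          by (simp add: mult.assoc[symmetric] powr_add[symmetric])
        also have "\<dots> \<le> t powr (\<sigma> - \<gamma> - \<delta>) * (D\<^sub>1 * ?h)"
          by (intro mult_left_mono Wx t) simp
        finally show "t powr (\<sigma> - \<gamma>) * norm (W t) \<le> D\<^sub>1 * ?h * t powr (\<sigma> - \<gamma> - \<delta>)"
          by (simp only: mult.commute)
      qed
      also have "\<dots> = D\<^sub>1 * ?h * integral {b..b + 1} (\<lambda>t. t powr (\<sigma> - \<gamma> - \<delta>))"
        by simp
      also have "\<dots> \<le> D\<^sub>1 * ?h * D\<^sub>3"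
      proof (rule mult_left_mono)
        show "integral {b..b + 1} (\<lambda>t. t powr (\<sigma> - \<gamma> - \<delta>)) \<le> D\<^sub>3"
          unfolding D\<^sub>3_def by (intro M_le b exps)
        show "0 \<le> D\<^sub>1 * ?h"
          by (rule order_trans[OF mult_nonneg_nonneg Wx[OF y]]) simp_all
      qed
      finally show ?thesis .
    qed
    have "y powr (\<beta> - \<gamma>) * norm (V y) \<le>
        2 powr ((\<beta> - \<gamma>) + 2 * \<beta> + 1) * integral {b..b + 1} (\<lambda>t. t powr (2 * \<beta> + 1) * norm (t powr \<alpha> *\<^sub>R W t)) +
        integral {b..b + 1} (\<lambda>t. t powr (\<beta> - \<gamma>) * norm (t powr \<alpha> *\<^sub>R W t))"
      using y adm' b par by (intro mean_zero_powr_bound[OF V]) auto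
    also have "\<dots> \<le> 2 powr ((\<beta> - \<gamma>) + 2 * \<beta> + 1) * (2 powr (\<beta> + \<gamma> + 1) * I) + I"
      unfolding I2 by (intro add_right_mono mult_left_mono I1) simp
    also have "\<dots> = D\<^sub>2 * I"
      by (simp add: D\<^sub>2_def distrib_right)
    also have "\<dots> \<le> D\<^sub>2 * (D\<^sub>1 * ?h * D\<^sub>3)"
      using pos by (intro mult_left_mono I3) auto
    finally show "y powr (\<beta> - \<gamma>) * norm (V y) \<le> D\<^sub>1 * D\<^sub>2 * D\<^sub>3 * sqrt (energy (\<alpha> + \<beta>) b W')"
      by (simp add: \<sigma>_def mult_ac)
  qed
qed

text \<open>The two ranges of \<open>b\<close> are joined and the estimate is squared; \<gamma> is
  half of \<nu> because the earlier bounds are for the norm of \<open>V\<close> and not for its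
  square.\<close>

lemma admissible_bound:
  assumes par: "\<alpha> \<ge> 0" "0 \<le> \<nu>" "\<nu> \<le> 2 * \<beta>" "\<nu> < 3" "\<beta> < 3 / 2 + \<alpha>"
  obtains C where "C > 0"
    "\<And>b V W (W'::real \<Rightarrow> 'a::euclidean_space) y. admissible \<alpha> \<beta> b V W W' \<Longrightarrow> 0 < b \<Longrightarrow> y \<in> {b..b + 1} \<Longrightarrow>
       (norm (y powr \<beta> *\<^sub>R V y))\<^sup>2 / y powr \<nu> \<le> C * energy (\<alpha> + \<beta>) b W'"
proof -
  define \<gamma> where "\<gamma> = \<nu> / 2"
  have \<gamma>: "0 \<le> \<gamma>" "\<gamma> \<le> \<beta>" "\<gamma> < 3 / 2"
    using par by (auto simp: \<gamma>_def)
  obtain C where C: "C > 0" "\<And>b V W (W'::real \<Rightarrow> 'a) y. admissible \<alpha> \<beta> b V W W' \<Longrightarrow> 0 < b \<Longrightarrow> b \<le> 1 \<Longrightarrow>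
      y \<in> {b..b + 1} \<Longrightarrow> y powr (\<beta> - \<gamma>) * norm (V y) \<le> C * sqrt (energy (\<alpha> + \<beta>) b W')"
    using admissible_bound_small[OF par(1) \<gamma> par(5)] by metis
  define K where "K = max C (2 powr (\<alpha> + \<beta>))"
  have "K > 0"
    using C(1) by (simp add: K_def less_max_iff_disj)
  show thesis
  proof
    show "K\<^sup>2 > 0" using \<open>K > 0\<close> by simp
    fix b y :: real and V W W' :: "real \<Rightarrow> 'a"
    assume adm: "admissible \<alpha> \<beta> b V W W'" and b: "0 < b" and y: "y \<in> {b..b + 1}"
    let ?h = "energy (\<alpha> + \<beta>) b W'"
    have h: "?h \<ge> 0" by (rule energy_nonneg)
    have "y powr (\<beta> - \<gamma>) * norm (V y) \<le> K * sqrt ?h"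
    proof (cases "b \<le> 1")
      case True
      have "y powr (\<beta> - \<gamma>) * norm (V y) \<le> C * sqrt ?h"
        by (rule C(2)[OF adm b True y])
      also have "\<dots> \<le> K * sqrt ?h"
        using h by (intro mult_right_mono) (auto simp: K_def)
      finally show ?thesis .
    next
      case False
      have "y powr (\<beta> - \<gamma>) * norm (V y) \<le> 2 powr (\<alpha> + \<beta>) * sqrt ?h"
        using False par \<gamma> y by (intro admissible_bound_large[OF adm]) auto
      also have "\<dots> \<le> K * sqrt ?h"
        using h by (intro mult_right_mono) (auto simp: K_def)
      finally show ?thesis .
    qed
    then have "(y powr (\<beta> - \<gamma>) * norm (V y))\<^sup>2 \<le> (K * sqrt ?h)\<^sup>2"
      by (intro power_mono) auto
    also have "\<dots> = K\<^sup>2 * ?h"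
      using h by (simp add: power_mult_distrib)
    also have "(y powr (\<beta> - \<gamma>) * norm (V y))\<^sup>2 = (norm (y powr \<beta> *\<^sub>R V y))\<^sup>2 / y powr \<nu>"
    proof -
      have "(y powr \<gamma>)\<^sup>2 = y powr \<nu>"
        using y b by (simp add: powr_power \<gamma>_def)
      then show ?thesis
        by (simp add: powr_diff power_mult_distrib power_divide)
    qed
    finally show "(norm (y powr \<beta> *\<^sub>R V y))\<^sup>2 / y powr \<nu> \<le> K\<^sup>2 * ?h" .
  qed
qed

subsection \<open>Passage to Sobolev functions\<close>

lemma square_integrable_add:
  fixes f g :: "'a::euclidean_space \<Rightarrow> 'b::euclidean_space"
  assumes S: "S \<in> sets lebesgue"
    and fg: "f absolutely_integrable_on S" "g absolutely_integrable_on S"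
    and f2: "(\<lambda>x. (norm (f x))\<^sup>2) integrable_on S" and g2: "(\<lambda>x. (norm (g x))\<^sup>2) integrable_on S"
  shows "(\<lambda>x. (norm (f x + g x))\<^sup>2) integrable_on S"
proof (rule absolutely_integrable_onD(1)[OF measurable_bounded_by_integrable_imp_absolutely_integrable[OF _ S]])
  have [measurable]: "f \<in> borel_measurable (lebesgue_on S)" "g \<in> borel_measurable (lebesgue_on S)"
    using fg by (simp_all add: absolutely_integrable_measurable[OF S])
  show "(\<lambda>x. (norm (f x + g x))\<^sup>2) \<in> borel_measurable (lebesgue_on S)"
    by measurable
  show "(\<lambda>x. 2 * (norm (f x))\<^sup>2 + 2 * (norm (g x))\<^sup>2) integrable_on S"
    by (intro integrable_add integrable_on_mult_right f2 g2)
  fix x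
  have "(norm (f x + g x))\<^sup>2 \<le> (norm (f x) + norm (g x))\<^sup>2"
    by (intro power_mono norm_triangle_ineq) simp
  also have "\<dots> \<le> 2 * (norm (f x))\<^sup>2 + 2 * (norm (g x))\<^sup>2"
    using sum_squares_bound[of "norm (f x)" "norm (g x)"] by (simp add: power2_sum)
  finally show "norm ((norm (f x + g x))\<^sup>2) \<le> 2 * (norm (f x))\<^sup>2 + 2 * (norm (g x))\<^sup>2"
    by simp
qed

lemma square_integrable_scaleR:
  fixes f :: "real \<Rightarrow> 'a::euclidean_space"
  assumes "continuous_on {a..b} A" "(\<lambda>x. (norm (f x))\<^sup>2) integrable_on {a..b}"
  shows "(\<lambda>x. (norm (A x *\<^sub>R f x))\<^sup>2) integrable_on {a..b}"
proof -
  have "(\<lambda>x. (norm (f x))\<^sup>2) absolutely_integrable_on {a..b}"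
    using assms(2) by (subst absolutely_integrable_on_iff_nonneg) auto
  then have "(\<lambda>x. (A x)\<^sup>2 *\<^sub>R (norm (f x))\<^sup>2) absolutely_integrable_on {a..b}"
    by (intro absolutely_integrable_scaleR_continuous continuous_intros assms(1))
  from absolutely_integrable_onD(1)[OF this] show ?thesis
    by (simp add: power_mult_distrib)
qed

lemma L2D:
  assumes "f \<in> L2 a b"
  shows "f absolutely_integrable_on {a..b}" and "(\<lambda>x. (norm (f x))\<^sup>2) integrable_on {a..b}"
proof -
  have f: "f \<in> borel_measurable (lebesgue_on {a<..<b})"
    and "integrable (lebesgue_on {a<..<b}) (\<lambda>x. (cmod (f x))\<^sup>2)"
    using assms by (auto simp: L2_def)
  then have "(\<lambda>x. (cmod (f x))\<^sup>2) absolutely_integrable_on {a<..<b}"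
    by (simp add: integrable_lebesgue_on_iff)
  note sq = absolutely_integrable_onD(1)[OF this]
  show "(\<lambda>x. (norm (f x))\<^sup>2) integrable_on {a..b}"
    using \<open>(\<lambda>x. (cmod (f x))\<^sup>2) absolutely_integrable_on {a<..<b}\<close>
    unfolding absolutely_integrable_on_open_interval_real by (rule absolutely_integrable_onD)
  have "f absolutely_integrable_on {a<..<b}"
  proof (rule measurable_bounded_by_integrable_imp_absolutely_integrable[OF f])
    have "(\<lambda>_. 1::real) absolutely_integrable_on {a<..<b}"
      unfolding absolutely_integrable_on_open_interval_real
      by (intro absolutely_integrable_continuous_real continuous_intros)
    from absolutely_integrable_onD(1)[OF this]
    show "(\<lambda>x. 1 + (cmod (f x))\<^sup>2) integrable_on {a<..<b}"
      by (intro integrable_add sq)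
    \<comment> \<open>Constants are integrable on a bounded interval, so this inequality puts L^2
      into L^1.\<close>
    show "norm (f x) \<le> 1 + (cmod (f x))\<^sup>2" for x
      using sum_squares_bound[of 1 "cmod (f x)"] norm_ge_zero[of "f x"]
      by (simp only: power_one)
  qed simp
  then show "f absolutely_integrable_on {a..b}"
    by (simp only: absolutely_integrable_on_open_interval_real)
qed

lemma primitive_on_add:
  fixes F :: "real \<Rightarrow> 'a::euclidean_space"
  assumes F: "primitive_on a b F f" and G: "primitive_on a b G g"
  shows "primitive_on a b (\<lambda>x. F x + G x) (\<lambda>x. f x + g x)"
  unfolding primitive_on_def
proof (intro conjI ballI)
  note f = primitive_onD(1)[OF F] and g = primitive_onD(1)[OF G]
  show "(\<lambda>x. f x + g x) absolutely_integrable_on {a..b}"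
    by (rule set_integral_add(1)[OF f g])
  fix x assume x: "x \<in> {a..b}"
  have "f integrable_on {a..x}" "g integrable_on {a..x}"
    using x by (auto intro!: absolutely_integrable_onD absolutely_integrable_on_subinterval[OF f]
        absolutely_integrable_on_subinterval[OF g])
  then have "integral {a..x} (\<lambda>x. f x + g x) = integral {a..x} f + integral {a..x} g"
    by (rule integral_add)
  moreover have "F x = F a + integral {a..x} f" "G x = G a + integral {a..x} g"
    using x by (auto intro: primitive_onD(2)[OF F] primitive_onD(2)[OF G])
  ultimately show "F x + G x = F a + G a + integral {a..x} (\<lambda>x. f x + g x)"
    by (metis (no_types, lifting) add.assoc add.left_commute)
qed

lemma primitive_on_cong_deriv:
  fixes F :: "real \<Rightarrow> 'a::euclidean_space"
  assumes F: "primitive_on a b F f" and eq: "negligible {x \<in> {a<..<b}. f x \<noteq> g x}"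
  shows "primitive_on a b F g"
  unfolding primitive_on_def
proof (intro conjI ballI)
  have neg: "negligible (insert a (insert b {x \<in> {a<..<b}. f x \<noteq> g x}))"
    using eq by simp
  show "g absolutely_integrable_on {a..b}"
    by (rule absolutely_integrable_spike[OF primitive_onD(1)[OF F] neg]) auto
  fix x assume x: "x \<in> {a..b}"
  then have "F x = F a + integral {a..x} f"
    by (intro primitive_onD(2)[OF F]) auto
  also have "integral {a..x} f = integral {a..x} g"
    by (rule integral_spike[OF neg]) (use x in auto)
  finally show "F x = F a + integral {a..x} g" .
qed

lemma LINT_open_interval_eq_integral_AE:
  fixes f :: "real \<Rightarrow> 'a::euclidean_space"
  assumes f: "f absolutely_integrable_on {a..b}" and eq: "negligible {x \<in> {a<..<b}. g x \<noteq> f x}"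
  shows "(LINT x|lebesgue_on {a<..<b}. g x) = integral {a..b} f"
proof -
  have neg: "negligible (insert a (insert b {x \<in> {a<..<b}. g x \<noteq> f x}))"
    using eq by simp
  have "g absolutely_integrable_on {a..b}"
    by (rule absolutely_integrable_spike[OF f neg]) auto
  then have "(LINT x|lebesgue_on {a<..<b}. g x) = integral {a..b} g"
    by (rule LINT_open_interval_eq_integral)
  also have "\<dots> = integral {a..b} f"
    by (rule integral_spike[OF neg]) auto
  finally show ?thesis .
qed

text \<open>Existence of \<open>g\<close> makes the value chosen by \<open>SOME\<close> a weak
  derivative; uniqueness up to null sets does the rest.\<close>

lemma weak_deriv_eq_AE:
  assumes "has_weak_deriv 1 a b f g"
  shows "negligible {x \<in> {a<..<b}. weak_deriv a b f x \<noteq> g x}"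
proof (rule has_weak_deriv_1_unique[OF _ assms])
  show "has_weak_deriv 1 a b f (weak_deriv a b f)"
    unfolding weak_deriv_def by (rule someI[of "has_weak_deriv 1 a b f", OF assms])
qed

lemma continuous_eq_if_AE_eq:
  fixes f g :: "real \<Rightarrow> 'a::euclidean_space"
  assumes "a < b" "continuous_on {a..b} f" "continuous_on {a..b} g"
    and eq: "negligible {x \<in> {a<..<b}. f x \<noteq> g x}" and x: "x \<in> {a..b}"
  shows "f x = g x"
proof -
  have cont: "continuous_on {a..b} (\<lambda>x. norm (f x - g x))"
    by (intro continuous_intros assms)
  have neg: "negligible (insert a (insert b {x \<in> {a<..<b}. f x \<noteq> g x}))"
    using eq by simp
  have "integral {a..b} (\<lambda>x. norm (f x - g x)) = integral {a..b} (\<lambda>_. 0)"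
    by (rule integral_spike[OF neg]) auto
  then have "\<forall>x\<in>{a..b}. norm (f x - g x) = 0"
    using integral_eq_0_iff[OF cont] assms(1) by simp
  then show ?thesis using x by simp
qed

text \<open>\<open>U\<close> witnesses the \<open>SOME\<close>, so the chosen function is continuous
  and almost everywhere equal to \<open>U\<close>; continuity then forces equality at every point,
  endpoints included.\<close>

lemma continuous_rep_eq:
  assumes "a < b" "continuous_on {a..b} U" and eq: "negligible {x \<in> {a<..<b}. u x \<noteq> U x}"
    and x: "x \<in> {a..b}"
  shows "continuous_rep a b u x = U x"
proof -
  let ?P = "\<lambda>v. continuous_on {a..b} v \<and> (AE x in lebesgue_on {a<..<b}. v x = u x)"
  have AE_iff: "(AE x in lebesgue_on {a<..<b}. v x = u x) \<longleftrightarrow> negligible {x \<in> {a<..<b}. v x \<noteq> u x}" for v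
    by (rule AE_lebesgue_on_iff_negligible) simp
  have "?P U"
    unfolding AE_iff using assms(2) eq by (simp add: eq_commute)
  then have P: "?P (continuous_rep a b u)"
    unfolding continuous_rep_def by (rule someI[of ?P U])
  have "negligible {x \<in> {a<..<b}. continuous_rep a b u x \<noteq> U x}"
    by (rule negligible_subset[OF negligible_Un[OF P[unfolded AE_iff, THEN conjunct2] eq]]) auto
  with P show ?thesis
    by (intro continuous_eq_if_AE_eq[OF assms(1) _ assms(2) _ x]) auto
qed

lemma sobolev_H_2_primitives:
  assumes u: "u \<in> sobolev_H 2 a b" and "a < b"
  obtains U U\<^sub>1 u\<^sub>2 where "primitive_on a b U U\<^sub>1" "primitive_on a b U\<^sub>1 u\<^sub>2" "u\<^sub>2 \<in> L2 a b"
    "negligible {x \<in> {a<..<b}. u x \<noteq> U x}"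
proof -
  have "\<forall>k\<le>2. \<exists>g\<in>L2 a b. has_weak_deriv k a b u g"
    using u by (simp add: sobolev_H_def)
  then obtain u\<^sub>1 u\<^sub>2 where u\<^sub>1: "u\<^sub>1 \<in> L2 a b" "has_weak_deriv 1 a b u u\<^sub>1"
    and u\<^sub>2: "u\<^sub>2 \<in> L2 a b" "has_weak_deriv 2 a b u u\<^sub>2"
    by (metis one_le_numeral order_refl)
  obtain U\<^sub>1 where U\<^sub>1: "primitive_on a b U\<^sub>1 u\<^sub>2" "negligible {x \<in> {a<..<b}. u\<^sub>1 x \<noteq> U\<^sub>1 x}"
    using has_weak_deriv_imp_primitive_on[OF has_weak_deriv_2_imp_1[OF u\<^sub>1(2) u\<^sub>2(2)] assms(2) L2D(1)[OF u\<^sub>2(1)]]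
    by metis
  obtain U where U: "primitive_on a b U u\<^sub>1" "negligible {x \<in> {a<..<b}. u x \<noteq> U x}"
    using has_weak_deriv_imp_primitive_on[OF u\<^sub>1(2) assms(2) L2D(1)[OF u\<^sub>1(1)]] by metis
  show thesis
    \<comment> \<open>\<open>U\<close> was built as a primitive of \<open>u\<^sub>1\<close>; the
      integrand is exchanged for its continuous version \<open>U\<^sub>1\<close>.\<close>
    by (rule that[OF primitive_on_cong_deriv[OF U(1) U\<^sub>1(2)] U\<^sub>1(1) u\<^sub>2(1) U(2)])
qed

text \<open>The product rule for primitives, applied with powers of x that are smooth on the
  interval because \<open>b > 0\<close>, yields genuine representatives of v, v', w and w'. The
  chosen weak derivatives agree with them off null sets, which the integrals do not see.\<close>

lemma sobolev_H_2_admissible: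
  assumes u: "u \<in> sobolev_H 2 b (b + 1)" and b: "b > 0"
    and c1: "(LINT x|lebesgue_on {b<..<b+1}. u x * of_real (x powr \<beta>)) = 0"
    and c2: "(LINT x|lebesgue_on {b<..<b+1}.
      weak_deriv b (b + 1) (\<lambda>s. u s / of_real (s powr \<beta>)) x * of_real (x powr \<alpha>)) = 0"
  obtains V W W' where "admissible \<alpha> \<beta> b V W W'"
    "\<And>y. y \<in> {b..b + 1} \<Longrightarrow> continuous_rep b (b + 1) u y = y powr \<beta> *\<^sub>R V y"
    "h_form \<alpha> \<beta> b u = energy (\<alpha> + \<beta>) b W'"
proof -
  define c where "c = b + 1"
  have bc: "b < c" by (simp add: c_def)
  obtain U U\<^sub>1 u\<^sub>2 where U: "primitive_on b c U U\<^sub>1" and U\<^sub>1: "primitive_on b c U\<^sub>1 u\<^sub>2"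
    and u\<^sub>2: "u\<^sub>2 \<in> L2 b c" and uU: "negligible {x \<in> {b<..<c}. u x \<noteq> U x}"
    using sobolev_H_2_primitives[OF u[folded c_def] bc] by blast
  note Uc = primitive_on_continuous[OF U] and U\<^sub>1c = primitive_on_continuous[OF U\<^sub>1]
  have pos: "x > 0" if "x \<in> {b..c}" for x
    using that b by auto
  have cont: "continuous_on {b..c} (\<lambda>x. x powr e)" for e :: real
    using b by (intro continuous_intros) auto
  \<comment> \<open>The coefficient \<open>k\<close> keeps the derivative in the same shape, so the
    rule can be iterated; the factors \<open>1 *\<close> in the definitions below serve to match
    it.\<close>
  have der: "((\<lambda>x. k * x powr e) has_real_derivative k * e * x powr (e - 1)) (at x within {b..c})"
    if "x \<in> {b..c}" for x e k :: real
    using pos[OF that] by (auto intro!: derivative_eq_intros)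
  have derc: "continuous_on {b..c} (\<lambda>x. k * e * x powr (e - 1))" for e k :: real
    by (intro continuous_on_mult continuous_on_const cont)
  note prim = primitive_on_scaleR[OF _ der derc]

  define V where "V x = (1 * x powr - \<beta>) *\<^sub>R U x" for x
  define V\<^sub>1 where "V\<^sub>1 x = (1 * - \<beta> * x powr (- \<beta> - 1)) *\<^sub>R U x + (1 * x powr - \<beta>) *\<^sub>R U\<^sub>1 x" for x
  have V: "primitive_on b c V V\<^sub>1"
    unfolding V_def V\<^sub>1_def by (rule prim[OF U])
  \<comment> \<open>\<open>R\<close> gathers the continuous terms of the second derivative of v; the
    only term that is merely square integrable is the one with \<open>u\<^sub>2\<close>.\<close>
  define R where "R x = ((1 * - \<beta> * (- \<beta> - 1) * x powr (- \<beta> - 1 - 1)) *\<^sub>R U x +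
      (1 * - \<beta> * x powr (- \<beta> - 1)) *\<^sub>R U\<^sub>1 x) + (1 * - \<beta> * x powr (- \<beta> - 1)) *\<^sub>R U\<^sub>1 x" for x
  define q where "q x = x powr - \<beta>" for x :: real
  have "primitive_on b c V\<^sub>1 (\<lambda>x. ((1 * - \<beta> * (- \<beta> - 1) * x powr (- \<beta> - 1 - 1)) *\<^sub>R U x +
      (1 * - \<beta> * x powr (- \<beta> - 1)) *\<^sub>R U\<^sub>1 x) +
      ((1 * - \<beta> * x powr (- \<beta> - 1)) *\<^sub>R U\<^sub>1 x + (1 * x powr - \<beta>) *\<^sub>R u\<^sub>2 x))"
    unfolding V\<^sub>1_def by (intro primitive_on_add prim U U\<^sub>1)
  then have V\<^sub>1: "primitive_on b c V\<^sub>1 (\<lambda>x. R x + q x *\<^sub>R u\<^sub>2 x)"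
    by (simp only: R_def q_def add.assoc mult_1)
  have Rc: "continuous_on {b..c} R"
    unfolding R_def by (intro continuous_on_add continuous_on_scaleR continuous_on_mult
        continuous_on_const cont Uc U\<^sub>1c)
  have qc: "continuous_on {b..c} q"
    unfolding q_def by (rule cont)
  define W where "W x = (1 * x powr - \<alpha>) *\<^sub>R V\<^sub>1 x" for x
  define W' where "W' x = (1 * - \<alpha> * x powr (- \<alpha> - 1)) *\<^sub>R V\<^sub>1 x +
      (1 * x powr - \<alpha>) *\<^sub>R (R x + q x *\<^sub>R u\<^sub>2 x)" for x
  have W: "primitive_on b c W W'"
    unfolding W_def W'_def by (rule prim[OF V\<^sub>1])
  note V\<^sub>1c = primitive_on_continuous[OF V\<^sub>1]

  have v: "has_weak_deriv 1 b c (\<lambda>s. u s / of_real (s powr \<beta>)) V\<^sub>1"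
  proof (rule primitive_on_imp_has_weak_deriv[OF V])
    show "negligible {x \<in> {b<..<c}. u x / of_real (x powr \<beta>) \<noteq> V x}"
      by (rule negligible_subset[OF uU])
        (auto simp: V_def powr_minus scaleR_conv_of_real divide_inverse mult.commute)
  qed (use bc in simp)
  define vd where "vd = weak_deriv b c (\<lambda>s. u s / of_real (s powr \<beta>))"
  have vd: "negligible {x \<in> {b<..<c}. vd x \<noteq> V\<^sub>1 x}"
    unfolding vd_def by (rule weak_deriv_eq_AE[OF v])
  have w: "has_weak_deriv 1 b c (\<lambda>t. (1 / of_real (t powr \<alpha>)) * vd t) W'"
  proof (rule primitive_on_imp_has_weak_deriv[OF W])
    show "negligible {x \<in> {b<..<c}. (1 / of_real (x powr \<alpha>)) * vd x \<noteq> W x}"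
      by (rule negligible_subset[OF vd])
        (auto simp: W_def powr_minus scaleR_conv_of_real divide_inverse)
  qed (use bc in simp)
  have wd: "negligible {x \<in> {b<..<c}. weak_deriv b c (\<lambda>t. (1 / of_real (t powr \<alpha>)) * vd t) x \<noteq> W' x}"
    by (rule weak_deriv_eq_AE[OF w])

  have W'2: "(\<lambda>t. (norm (W' t))\<^sup>2) integrable_on {b..c}"
  proof -
    \<comment> \<open>\<open>W'\<close> splits into the continuous part \<open>P\<close> and a
      continuous multiple \<open>Q\<close> of the L^2 function \<open>u\<^sub>2\<close>.\<close>
    define P Q where "P x = (1 * - \<alpha> * x powr (- \<alpha> - 1)) *\<^sub>R V\<^sub>1 x + x powr - \<alpha> *\<^sub>R R x"
      and "Q x = (x powr - \<alpha> * q x) *\<^sub>R u\<^sub>2 x" for x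
    have Pc: "continuous_on {b..c} P"
      unfolding P_def by (intro continuous_on_add continuous_on_scaleR continuous_on_mult
          continuous_on_const cont V\<^sub>1c Rc)
    have Qc: "continuous_on {b..c} (\<lambda>x. x powr - \<alpha> * q x)"
      by (intro continuous_on_mult cont qc)
    have "(\<lambda>x. (norm (P x + Q x))\<^sup>2) integrable_on {b..c}"
    proof (rule square_integrable_add)
      show "P absolutely_integrable_on {b..c}"
        by (rule absolutely_integrable_continuous_real[OF Pc])
      show "Q absolutely_integrable_on {b..c}"
        unfolding Q_def by (rule absolutely_integrable_scaleR_continuous[OF Qc L2D(1)[OF u\<^sub>2]])
      show "(\<lambda>x. (norm (P x))\<^sup>2) integrable_on {b..c}"
        by (intro integrable_continuous_real continuous_on_power continuous_on_norm Pc)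
      show "(\<lambda>x. (norm (Q x))\<^sup>2) integrable_on {b..c}"
        unfolding Q_def by (rule square_integrable_scaleR[OF Qc L2D(2)[OF u\<^sub>2]])
    qed simp
    moreover have "P x + Q x = W' x" for x
      by (simp add: P_def Q_def W'_def scaleR_add_right)
    ultimately show ?thesis by simp
  qed

  show thesis
  proof
    show "admissible \<alpha> \<beta> b V W W'"
      unfolding admissible_def c_def[symmetric]
    proof (intro conjI W W'2)
      have eq: "x powr \<alpha> *\<^sub>R W x = V\<^sub>1 x" if "x \<in> {b..c}" for x
        using pos[OF that] by (simp add: W_def powr_add[symmetric])
      have "{x \<in> {b<..<c}. V\<^sub>1 x \<noteq> x powr \<alpha> *\<^sub>R W x} = {}"
        using eq by auto
      then show "primitive_on b c V (\<lambda>t. t powr \<alpha> *\<^sub>R W t)"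
        by (intro primitive_on_cong_deriv[OF V]) (simp only: negligible_empty)
      have "(LINT x|lebesgue_on {b<..<c}. vd x * of_real (x powr \<alpha>)) =
          integral {b..c} (\<lambda>x. x powr \<alpha> *\<^sub>R V\<^sub>1 x)"
      proof (rule LINT_open_interval_eq_integral_AE)
        show "(\<lambda>x. x powr \<alpha> *\<^sub>R V\<^sub>1 x) absolutely_integrable_on {b..c}"
          by (intro absolutely_integrable_continuous_real continuous_on_scaleR cont V\<^sub>1c)
        show "negligible {x \<in> {b<..<c}. vd x * of_real (x powr \<alpha>) \<noteq> x powr \<alpha> *\<^sub>R V\<^sub>1 x}"
          by (rule negligible_subset[OF vd]) (auto simp: scaleR_conv_of_real)
      qed
      also have "\<dots> = integral {b..c} (\<lambda>x. x powr (2 * \<alpha>) *\<^sub>R W x)"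
        by (intro integral_cong) (simp add: W_def powr_add[symmetric])
      finally show "integral {b..c} (\<lambda>x. x powr (2 * \<alpha>) *\<^sub>R W x) = 0"
        using c2 unfolding vd_def c_def by simp
      have "(LINT x|lebesgue_on {b<..<c}. u x * of_real (x powr \<beta>)) =
          integral {b..c} (\<lambda>x. x powr \<beta> *\<^sub>R U x)"
      proof (rule LINT_open_interval_eq_integral_AE)
        show "(\<lambda>x. x powr \<beta> *\<^sub>R U x) absolutely_integrable_on {b..c}"
          by (intro absolutely_integrable_continuous_real continuous_on_scaleR cont Uc)
        show "negligible {x \<in> {b<..<c}. u x * of_real (x powr \<beta>) \<noteq> x powr \<beta> *\<^sub>R U x}"
          by (rule negligible_subset[OF uU]) (auto simp: scaleR_conv_of_real)
      qed
      also have "\<dots> = integral {b..c} (\<lambda>x. x powr (2 * \<beta>) *\<^sub>R V x)"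
        by (intro integral_cong) (simp add: V_def powr_add[symmetric])
      finally show "integral {b..c} (\<lambda>x. x powr (2 * \<beta>) *\<^sub>R V x) = 0"
        using c1 unfolding c_def by simp
    qed
    show "continuous_rep b (b + 1) u y = y powr \<beta> *\<^sub>R V y" if "y \<in> {b..b + 1}" for y
    proof -
      have "y > 0" using that b by simp
      then have "y powr \<beta> *\<^sub>R V y = U y"
        by (simp add: V_def powr_add[symmetric])
      then show ?thesis
        using continuous_rep_eq[OF bc Uc uU, of y] that unfolding c_def by simp
    qed
    have "(LINT x|lebesgue_on {b<..<c}. (cmod (weak_deriv b c (\<lambda>t. (1 / of_real (t powr \<alpha>)) * vd t) x))\<^sup>2
          * x powr (2 * (\<alpha> + \<beta>))) = integral {b..c} (\<lambda>x. (norm (W' x))\<^sup>2 * x powr (2 * (\<alpha> + \<beta>)))"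
    proof (rule LINT_open_interval_eq_integral_AE)
      have "(\<lambda>x. (norm (W' x))\<^sup>2) absolutely_integrable_on {b..c}"
        using W'2 by (subst absolutely_integrable_on_iff_nonneg) auto
      from absolutely_integrable_scaleR_continuous[OF cont[of "2 * (\<alpha> + \<beta>)"] this]
      show "(\<lambda>x. (norm (W' x))\<^sup>2 * x powr (2 * (\<alpha> + \<beta>))) absolutely_integrable_on {b..c}"
        by (simp add: mult.commute)
      show "negligible {x \<in> {b<..<c}. (cmod (weak_deriv b c (\<lambda>t. (1 / of_real (t powr \<alpha>)) * vd t) x))\<^sup>2
          * x powr (2 * (\<alpha> + \<beta>)) \<noteq> (norm (W' x))\<^sup>2 * x powr (2 * (\<alpha> + \<beta>))}"
        by (rule negligible_subset[OF wd]) auto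
    qed
    then show "h_form \<alpha> \<beta> b u = energy (\<alpha> + \<beta>) b W'"
      by (simp only: h_form_def energy_def vd_def c_def)
  qed
qed

text \<open>Taking the supremum in the extended reals makes its finiteness part of the claim, and
  only a bound at each \<open>y\<close> has to be shown.\<close>

theorem lemma3p2:
  fixes \<alpha> \<beta> \<nu> :: real
  assumes "\<alpha> \<ge> 0" and "0 \<le> \<beta>" and "\<beta> < 3 / 2 + \<alpha>"
    and "0 \<le> \<nu>" and "\<nu> < 3" and "\<nu> \<le> 2 * \<beta>"
  shows "\<exists>C>0. \<forall>b>0. \<forall>u \<in> sobolev_H 2 b (b + 1).
           (LINT x|lebesgue_on {b<..<b+1}. u x * of_real (x powr \<beta>)) = 0 \<longrightarrow>
           (LINT x|lebesgue_on {b<..<b+1}.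
              weak_deriv b (b + 1) (\<lambda>s. u s / of_real (s powr \<beta>)) x * of_real (x powr \<alpha>)) = 0 \<longrightarrow>
           (SUP y\<in>{b..b+1}. ereal ((cmod (continuous_rep b (b + 1) u y))\<^sup>2 / y powr \<nu>))
             \<le> ereal (C * h_form \<alpha> \<beta> b u)"
proof -
  obtain C where C: "C > 0" "\<And>b V W (W'::real \<Rightarrow> complex) y. admissible \<alpha> \<beta> b V W W' \<Longrightarrow> 0 < b \<Longrightarrow>
      y \<in> {b..b + 1} \<Longrightarrow> (norm (y powr \<beta> *\<^sub>R V y))\<^sup>2 / y powr \<nu> \<le> C * energy (\<alpha> + \<beta>) b W'"
    using admissible_bound[OF assms(1,4,6,5,3)] by metis
  show ?thesis
  proof (intro exI[of _ C] conjI allI impI ballI C(1))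
    fix b :: real and u :: "real \<Rightarrow> complex"
    assume b: "b > 0" and u: "u \<in> sobolev_H 2 b (b + 1)"
      and c: "(LINT x|lebesgue_on {b<..<b+1}. u x * of_real (x powr \<beta>)) = 0"
        "(LINT x|lebesgue_on {b<..<b+1}.
          weak_deriv b (b + 1) (\<lambda>s. u s / of_real (s powr \<beta>)) x * of_real (x powr \<alpha>)) = 0"
    obtain V W W' where adm: "admissible \<alpha> \<beta> b V W W'"
      and rep: "\<And>y. y \<in> {b..b + 1} \<Longrightarrow> continuous_rep b (b + 1) u y = y powr \<beta> *\<^sub>R V y"
      and h: "h_form \<alpha> \<beta> b u = energy (\<alpha> + \<beta>) b W'"
      using sobolev_H_2_admissible[OF u b c] by metis
    show "(SUP y\<in>{b..b+1}. ereal ((cmod (continuous_rep b (b + 1) u y))\<^sup>2 / y powr \<nu>))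
        \<le> ereal (C * h_form \<alpha> \<beta> b u)"
    proof (rule SUP_least)
      fix y assume y: "y \<in> {b..b + 1}"
      show "ereal ((cmod (continuous_rep b (b + 1) u y))\<^sup>2 / y powr \<nu>) \<le> ereal (C * h_form \<alpha> \<beta> b u)"
        unfolding rep[OF y] h ereal_less_eq by (rule C(2)[OF adm b y])
    qed
  qed
qed

end
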